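(* Let $(X,d)$ be a nonempty compact metric space. Then there exists a chain development $f\colon X\to\mathbb{R}$ if and only if $w(X,d)<\infty$. Moreover, when chain developments exist, $w(X,d)$ is the minimal possible diameter of a chain development of $X$ (that is, every chain development $f$ of $X$ satisfies $\operatorname{diam} f(X)\geqslant w(X,d)$, and equality holds for some chain development).
   Context: Let $(X,d)$ be a metric space. For $\varepsilon\geqslant 0$, a finite sequence of points $x=x_0,x_1,\ldots,x_n=y$ of $X$ is an $\varepsilon$-chain from $x$ to $y$ if $d(x_i,x_{i+1})\leqslant\varepsilon$ for all $i$. The chain distance $c(x,y)$ is the infimum of all $\varepsilon$ such that there exists an $\varepsilon$-chain from $x$ to $y$ in $X$. (It may happen that $c(x,y)=0$ for $x\neq y$.) It satisfies $c(x,z)\leqslant\max(c(x,y),c(y,z))$. A function $f\colon X\to\mathbb{R}$ (not assumed continuous or injective) is called a chain development of $X$ if $c(x,y)=\tilde c(f(x),f(y))$ for all $x,y\in X$, where $c$ is the chain distance on $(X,d)$ and $\tilde c$ is the chain distance on the set $f(X)\subset\mathbb{R}$ with the usual distance $|s-t|$ (chains are required to stay in $f(X)$). The diameter of a chain development $f$ is $\operatorname{diam} f(X)=\sup f(X)-\inf f(X)\in[0,\infty]$. For a nonempty compact metric space $(X,d)$ the rooted labeled tree $T(X,d)$ is constructed as follows. Each vertex $v$ has an associated subset (cluster) $Q(v)\subset X$ and the label $r(v)=\max_{x,y\in Q(v)}c(x,y)$ (the $c$-diameter of $Q(v)$, where $c$ is always the chain distance on the whole space $(X,d)$). The root $v_0$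 has $Q(v_0)=X$. If $r(v)>0$, then the relation $c(x,y)<r(v)$ is an equivalence relation on $Q(v)$ with finitely many classes; $v$ has exactly one child for each class, and the cluster of that child is the class. If $r(v)=0$, then $v$ has no children. Let $n(v)$ denote the number of children of $v$. The width of $(X,d)$ is $w(X,d)=\sum_v r(v)(n(v)-1)\in[0,\infty]$, where the sum is over all vertices $v$ of $T(X,d)$ (vertices with $r(v)=0$ contribute $0$). *)

theory Defs
  imports "HOL-Analysis.Analysis"
begin

text \<open>A metric space is a carrier \<open>X\<close> with a distance function \<open>d\<close>, so that the same notion of
  chain distance applies to \<open>(X, d)\<close> and to a subset of the real line.\<close>

definition eps_chain :: "'a set \<Rightarrow> ('a \<Rightarrow> 'a \<Rightarrow> real) \<Rightarrow> real \<Rightarrow> 'a \<Rightarrow> 'a \<Rightarrow> 'a list \<Rightarrow> bool" where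
  "eps_chain X d e x y xs \<longleftrightarrow>
     xs \<noteq> [] \<and> hd xs = x \<and> last xs = y \<and> set xs \<subseteq> X \<and>
     (\<forall>i. Suc i < length xs \<longrightarrow> d (xs ! i) (xs ! Suc i) \<le> e)"

definition chain_dist :: "'a set \<Rightarrow> ('a \<Rightarrow> 'a \<Rightarrow> real) \<Rightarrow> 'a \<Rightarrow> 'a \<Rightarrow> real" where
  "chain_dist X d x y = Inf {e. 0 \<le> e \<and> (\<exists>xs. eps_chain X d e x y xs)}"

definition chain_development :: "'a set \<Rightarrow> ('a \<Rightarrow> 'a \<Rightarrow> real) \<Rightarrow> ('a \<Rightarrow> real) \<Rightarrow> bool" where
  "chain_development X d f \<longleftrightarrow>
     (\<forall>x\<in>X. \<forall>y\<in>X. chain_dist X d x y = chain_dist (f ` X) (\<lambda>s t. \<bar>s - t\<bar>) (f x) (f y))"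

definition development_diam :: "'a set \<Rightarrow> ('a \<Rightarrow> real) \<Rightarrow> ereal" where
  "development_diam X f = (SUP x\<in>X. ereal (f x)) - (INF x\<in>X. ereal (f x))"

text \<open>The supremum is attained for every cluster of a compact space, so it is the maximum
  (\<^const>\<open>Max\<close> is of no use here, as the set of values may be infinite).\<close>

definition chain_diam :: "'a set \<Rightarrow> ('a \<Rightarrow> 'a \<Rightarrow> real) \<Rightarrow> 'a set \<Rightarrow> real" where
  "chain_diam X d Q = (SUP (x, y)\<in>Q \<times> Q. chain_dist X d x y)"

definition cluster_classes :: "'a set \<Rightarrow> ('a \<Rightarrow> 'a \<Rightarrow> real) \<Rightarrow> 'a set \<Rightarrow> 'a set set" where
  "cluster_classes X d Q =
     Q // {(x, y). x \<in> Q \<and> y \<in> Q \<and> chain_dist X d x y < chain_diam X d Q}"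

text \<open>A vertex is represented by the list of clusters met on the path from the vertex up to the
  root; its own cluster is the head of the list and its parent is the tail.\<close>

type_synonym 'a vertex = "'a set list"

definition cluster :: "'a vertex \<Rightarrow> 'a set" where
  "cluster v = hd v"

definition label :: "'a set \<Rightarrow> ('a \<Rightarrow> 'a \<Rightarrow> real) \<Rightarrow> 'a vertex \<Rightarrow> real" where
  "label X d v = chain_diam X d (cluster v)"

definition children :: "'a set \<Rightarrow> ('a \<Rightarrow> 'a \<Rightarrow> real) \<Rightarrow> 'a vertex \<Rightarrow> 'a vertex set" where
  "children X d v =
     (if label X d v > 0 then (\<lambda>C. C # v) ` cluster_classes X d (cluster v) else {})"

inductive_set tree_vertices :: "'a set \<Rightarrow> ('a \<Rightarrow> 'a \<Rightarrow> real) \<Rightarrow> 'a vertex set"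
  for X :: "'a set" and d :: "'a \<Rightarrow> 'a \<Rightarrow> real" where
  root: "[X] \<in> tree_vertices X d"
| child: "v \<in> tree_vertices X d \<Longrightarrow> u \<in> children X d v \<Longrightarrow> u \<in> tree_vertices X d"

text \<open>For compact \<open>(X, d)\<close> every vertex has finitely many children, so \<^const>\<open>card\<close> counts them
  correctly. The summands are nonnegative: \<open>n(v) \<ge> 2\<close> if \<open>r(v) > 0\<close>, and if \<open>r(v) = 0\<close> the summand
  is \<open>0 * (0 - 1) = 0\<close>. The sum therefore always exists in the extended reals.\<close>

definition width :: "'a set \<Rightarrow> ('a \<Rightarrow> 'a \<Rightarrow> real) \<Rightarrow> ereal" where
  "width X d =
     (\<Sum>\<^sub>\<infinity>v\<in>tree_vertices X d. ereal (label X d v * (real (card (children X d v)) - 1)))"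

end

theory Submission
  imports Defs
begin

text \<open>The chain distance \<open>c\<close> is an ultrametric, so for every \<open>t > 0\<close> the space falls into classes of
  the relation \<open>c x y \<le> t\<close>; by compactness there are finitely many, say \<open>N(t)\<close>. A vertex \<open>v\<close> of the
  tree splits one class into \<open>n(v)\<close> pieces as soon as \<open>t\<close> drops below \<open>r(v)\<close>, so \<open>N(t) - 1\<close> is the
  sum of \<open>n(v) - 1\<close> over the vertices with \<open>r(v) > t\<close>, and integrating over \<open>t > 0\<close> gives
  \<open>w = \<integral> (N(t) - 1) dt\<close> (\<open>width_eq_class_integral\<close>), a quantity that depends on the
  ultrametric alone.

  Call a total preorder on the space convex if \<open>c x z = max (c x y) (c y z)\<close> whenever \<open>x \<le> y \<le> z\<close>.
  Then classes are order-intervals, and one can count the \<open>t\<close>-classes strictly to the left of the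
  class of \<open>x\<close>; this is \<open>rank t x\<close>. Two facts drive the proof. If \<open>x \<le> y\<close> and \<open>t < c x y\<close>, then
  \<open>rank t x < rank t y\<close>. If \<open>x \<le> y\<close> and every point between is within \<open>e\<close> of \<open>x\<close> or of \<open>y\<close>, then
  for \<open>t \<ge> e\<close> the two ranks differ by one if \<open>t < c x y\<close> and agree otherwise. Any two points are joined by finitely many such
  adjacent pairs (\<open>split_induct\<close>).

  Lower bound: a chain development \<open>f\<close> induces a convex order, and \<open>c x y \<le> |f x - f y|\<close>. Summing the
  second fact along adjacent pairs bounds the integral of the difference of ranks of two points by the
  distance of their images. By compactness there are points \<open>a\<close> and \<open>b\<close> beyond which \<open>f(X)\<close> has no
  more gaps, where the ranks are \<open>0\<close> and \<open>N(t) - 1\<close>; hence \<open>w \<le> f b - f a\<close>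
  (\<open>class_integral_le_span\<close>), which is finite even if \<open>f(X)\<close> is unbounded.

  Existence: a convex order always exists (\<open>convex_order_exists\<close>). If \<open>w\<close> is finite, place \<open>x\<close> at
  \<open>\<integral> rank t x dt\<close>, a point of \<open>[0, w]\<close>. By the first fact points move at least
  \<open>c\<close> apart, so no chain in the image is finer than it should be; by the second fact adjacent points
  move apart by at most \<open>c\<close> plus the integral of \<open>N(t) - 1\<close> over a short interval at \<open>0\<close>, so the
  image has all the chains it needs (\<open>chain_dist_position\<close>).\<close>

section \<open>Chain distances are ultrametrics\<close>

definition chain_step :: "'a set \<Rightarrow> ('a \<Rightarrow> 'a \<Rightarrow> real) \<Rightarrow> real \<Rightarrow> 'a \<Rightarrow> 'a \<Rightarrow> bool" where
  "chain_step X d e u v \<longleftrightarrow> u \<in> X \<and> v \<in> X \<and> d u v \<le> e"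

lemma eps_chain_Cons_Cons:
  "eps_chain X d e x y (a # b # xs) \<longleftrightarrow> a = x \<and> x \<in> X \<and> d x b \<le> e \<and> eps_chain X d e b y (b # xs)"
proof -
  have "(\<forall>i. Suc i < length (a # b # xs) \<longrightarrow> d ((a # b # xs) ! i) ((a # b # xs) ! Suc i) \<le> e) \<longleftrightarrow>
    d a b \<le> e \<and> (\<forall>i. Suc i < length (b # xs) \<longrightarrow> d ((b # xs) ! i) ((b # xs) ! Suc i) \<le> e)"
    (is "?l \<longleftrightarrow> ?r")
  proof
    assume l: ?l
    show ?r
      using l[rule_format, of 0] l[rule_format, of "Suc i" for i] by auto
  next
    assume ?r
    then show ?l by (auto simp: nth_Cons split: nat.split)
  qed
  then show ?thesis unfolding eps_chain_def by auto
qed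

text \<open>With chains replaced by the reflexive transitive closure of a single step, concatenation and
  reversal of chains are transitivity and symmetry of the closure.\<close>

lemma eps_chain_iff_reachable:
  "(\<exists>xs. eps_chain X d e x y xs) \<longleftrightarrow> x \<in> X \<and> (chain_step X d e)\<^sup>*\<^sup>* x y"
proof
  have "x \<in> X \<and> (chain_step X d e)\<^sup>*\<^sup>* x y" if "eps_chain X d e x y xs" for xs
    using that
  proof (induction xs arbitrary: x rule: induct_list012)
    case 1
    then show ?case by (simp add: eps_chain_def)
  next
    case (2 a)
    then show ?case by (auto simp: eps_chain_def)
  next
    case (3 a b xs)
    then have "b \<in> X \<and> (chain_step X d e)\<^sup>*\<^sup>* b y" "x \<in> X" "d x b \<le> e"
      unfolding eps_chain_Cons_Cons by auto
    then show ?case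
      by (metis chain_step_def converse_rtranclp_into_rtranclp)
  qed
  then show "\<exists>xs. eps_chain X d e x y xs \<Longrightarrow> x \<in> X \<and> (chain_step X d e)\<^sup>*\<^sup>* x y" by blast
next
  assume *: "x \<in> X \<and> (chain_step X d e)\<^sup>*\<^sup>* x y"
  then have "(chain_step X d e)\<^sup>*\<^sup>* x y" "x \<in> X" by auto
  then show "\<exists>xs. eps_chain X d e x y xs"
  proof (induction rule: converse_rtranclp_induct)
    case base
    then have "eps_chain X d e y y [y]" by (simp add: eps_chain_def)
    then show ?case ..
  next
    case (step x z)
    then obtain xs where xs: "eps_chain X d e z y xs" by (auto simp: chain_step_def)
    then obtain zs where "xs = z # zs" by (cases xs) (auto simp: eps_chain_def)
    with xs step have "eps_chain X d e x y (x # z # zs)"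
      unfolding eps_chain_Cons_Cons by (auto simp: chain_step_def)
    then show ?case ..
  qed
qed

lemma chain_dist_eq_Inf_reachable:
  "x \<in> X \<Longrightarrow> chain_dist X d x y = Inf {e. 0 \<le> e \<and> (chain_step X d e)\<^sup>*\<^sup>* x y}"
  by (simp add: chain_dist_def eps_chain_iff_reachable)

lemma chain_dist_le:
  assumes "x \<in> X" "0 \<le> e" "(chain_step X d e)\<^sup>*\<^sup>* x y"
  shows "chain_dist X d x y \<le> e"
  unfolding chain_dist_eq_Inf_reachable[OF assms(1)]
  using assms by (intro cInf_lower bdd_belowI[of _ 0]) auto

lemma reachable_mono:
  assumes "(chain_step X d e)\<^sup>*\<^sup>* x y" "e \<le> e'"
  shows "(chain_step X d e')\<^sup>*\<^sup>* x y"
proof -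
  have "chain_step X d e \<le> chain_step X d e'" using assms(2) by (auto simp: chain_step_def)
  from rtranclp_mono[OF this] assms(1) show ?thesis by auto
qed

context Metric_space
begin

lemma reachable_dist: "x \<in> M \<Longrightarrow> y \<in> M \<Longrightarrow> (chain_step M d (d x y))\<^sup>*\<^sup>* x y"
  by (intro r_into_rtranclp) (simp add: chain_step_def)

lemma chain_dist_le_dist: "x \<in> M \<Longrightarrow> y \<in> M \<Longrightarrow> chain_dist M d x y \<le> d x y"
  by (intro chain_dist_le reachable_dist) auto

lemma reachable_if_chain_dist_less:
  assumes "x \<in> M" "y \<in> M" "chain_dist M d x y < e"
  shows "(chain_step M d e)\<^sup>*\<^sup>* x y"
proof -
  have "{e. 0 \<le> e \<and> (chain_step M d e)\<^sup>*\<^sup>* x y} \<noteq> {}"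
    using reachable_dist[OF assms(1,2)] nonneg by blast
  from cInf_lessD[OF this] assms obtain e' where "e' < e" "(chain_step M d e')\<^sup>*\<^sup>* x y"
    unfolding chain_dist_eq_Inf_reachable[OF assms(1)] by auto
  then show ?thesis by (auto intro: reachable_mono)
qed

lemma chain_dist_nonneg:
  assumes "x \<in> M" "y \<in> M"
  shows "0 \<le> chain_dist M d x y"
  unfolding chain_dist_eq_Inf_reachable[OF assms(1)]
  using reachable_dist[OF assms(1,2)] nonneg[of x y] by (intro cInf_greatest) blast+

lemma chain_dist_refl: "x \<in> M \<Longrightarrow> chain_dist M d x x = 0"
  using chain_dist_le[of x M 0 d x] chain_dist_nonneg[of x x] by auto

lemma chain_dist_commute:
  assumes "x \<in> M" "y \<in> M"
  shows "chain_dist M d x y = chain_dist M d y x"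
proof -
  have "symp (chain_step M d e)" for e by (auto simp: symp_def chain_step_def commute)
  then have "symp (chain_step M d e)\<^sup>*\<^sup>*" for e by (rule symp_rtranclp)
  then have "(chain_step M d e)\<^sup>*\<^sup>* x y \<longleftrightarrow> (chain_step M d e)\<^sup>*\<^sup>* y x" for e
    by (meson sympD)
  then show ?thesis using assms by (simp add: chain_dist_eq_Inf_reachable)
qed

text \<open>Both distances are realised up to a slack \<open>e\<close>, as the infimum need not be attained; the two
  chains are concatenated at \<open>y\<close>.\<close>

lemma chain_dist_ultra:
  assumes "x \<in> M" "y \<in> M" "z \<in> M"
  shows "chain_dist M d x z \<le> max (chain_dist M d x y) (chain_dist M d y z)"
proof (rule field_le_epsilon)
  fix e :: real assume "0 < e"
  define m where "m = max (chain_dist M d x y) (chain_dist M d y z)"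
  have "(chain_step M d (m + e))\<^sup>*\<^sup>* x y" "(chain_step M d (m + e))\<^sup>*\<^sup>* y z"
    using assms \<open>0 < e\<close> by (auto intro!: reachable_if_chain_dist_less simp: m_def)
  then have "(chain_step M d (m + e))\<^sup>*\<^sup>* x z" by (rule rtranclp_trans)
  moreover have "0 \<le> m + e"
    using chain_dist_nonneg[OF assms(1,2)] \<open>0 < e\<close> by (auto simp: m_def)
  ultimately show "chain_dist M d x z \<le> m + e" using assms by (intro chain_dist_le)
qed

end

lemma Metric_space_real_subset: "Metric_space A (\<lambda>s t :: real. \<bar>s - t\<bar>)"
  by unfold_locales auto

text \<open>On the line, a chain from \<open>s\<close> to \<open>u\<close> becomes one from \<open>s\<close> to \<open>t\<close> or from \<open>t\<close> to \<open>u\<close> by clipping it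
  at \<open>t\<close>: the clipping maps \<open>min t\<close> and \<open>max t\<close> do not increase distances and keep the chain in \<open>A\<close>.
  This makes the order that a chain development induces convex.\<close>

lemma real_chain_dist_mono:
  fixes A :: "real set"
  assumes "s \<in> A" "t \<in> A" "u \<in> A" "s \<le> t" "t \<le> u"
  shows "chain_dist A (\<lambda>s t. \<bar>s - t\<bar>) s t \<le> chain_dist A (\<lambda>s t. \<bar>s - t\<bar>) s u"
    and "chain_dist A (\<lambda>s t. \<bar>s - t\<bar>) t u \<le> chain_dist A (\<lambda>s t. \<bar>s - t\<bar>) s u"
proof -
  interpret R: Metric_space A "\<lambda>s t :: real. \<bar>s - t\<bar>" by (rule Metric_space_real_subset)
  let ?c = "chain_dist A (\<lambda>s t. \<bar>s - t\<bar>)" and ?step = "chain_step A (\<lambda>s t. \<bar>s - t\<bar>)"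
  have clip: "(?step e)\<^sup>*\<^sup>* (h v) (h w)"
    if "(?step e)\<^sup>*\<^sup>* v w" "\<And>v. v \<in> A \<Longrightarrow> h v \<in> A" "\<And>v w. \<bar>h v - h w\<bar> \<le> \<bar>v - w\<bar>" for h e v w
    using that(1)
  proof (induction rule: rtranclp_induct)
    case (step w w')
    then have "?step e (h w) (h w')"
      using that(2) that(3)[of w w'] by (auto simp: chain_step_def intro: order_trans)
    with step.IH show ?case by simp
  qed simp
  have "?c s t \<le> ?c s u + e \<and> ?c t u \<le> ?c s u + e" if "0 < e" for e
  proof -
    have su: "(?step (?c s u + e))\<^sup>*\<^sup>* s u"
      using assms that by (intro R.reachable_if_chain_dist_less) auto
    have "(?step (?c s u + e))\<^sup>*\<^sup>* (min t s) (min t u)"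
      using assms by (intro clip[OF su, of "min t"]) (auto simp: min_def)
    moreover have "(?step (?c s u + e))\<^sup>*\<^sup>* (max t s) (max t u)"
      using assms by (intro clip[OF su, of "max t"]) (auto simp: max_def)
    moreover have "0 \<le> ?c s u + e" using R.chain_dist_nonneg[of s u] assms that by auto
    moreover have "min t s = s" "min t u = t" "max t s = t" "max t u = u" using assms by auto
    ultimately show ?thesis using assms by (simp add: chain_dist_le)
  qed
  then show "?c s t \<le> ?c s u" "?c t u \<le> ?c s u" by (meson field_le_epsilon)+
qed


section \<open>Integrals of step functions on the half-line\<close>

text \<open>The number of classes decreases in the scale \<open>t > 0\<close>. At scale \<open>0\<close> there may be infinitely many
  classes, so monotonicity is available at positive scales only.\<close>

lemma antitone_nat_borel_measurable:
  fixes g :: "real \<Rightarrow> nat"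
  assumes "\<And>s t. 0 < s \<Longrightarrow> s \<le> t \<Longrightarrow> g t \<le> g s" and "S \<subseteq> {0<..}" and "S \<in> sets borel"
  shows "(\<lambda>t. of_nat (g t) * indicator S t :: ennreal) \<in> borel_measurable lborel"
proof -
  have "mono_on {0<..} (\<lambda>t. - real (g t))" using assms(1) by (auto intro!: mono_onI)
  then have "(\<lambda>t. - real (g t)) \<in> borel_measurable (restrict_space borel {0<..})"
    by (intro borel_measurable_mono_on_fnc)
  then have "(\<lambda>t. ennreal (- (- real (g t)))) \<in> borel_measurable (restrict_space borel {0<..})"
    by measurable
  then have "(\<lambda>t. of_nat (g t) :: ennreal) \<in> borel_measurable (restrict_space borel {0<..})"
    by (simp add: ennreal_of_nat_eq_real_of_nat)
  then have "(\<lambda>t. of_nat (g t) * indicator {0<..} t :: ennreal) \<in> borel_measurable borel"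
    by (subst (asm) borel_measurable_restrict_space_iff_ennreal) auto
  then have "(\<lambda>t. of_nat (g t) * indicator {0<..} t * indicator S t :: ennreal) \<in> borel_measurable borel"
    using assms(3) by measurable
  also have "(\<lambda>t. of_nat (g t) * indicator {0<..} t * indicator S t) = (\<lambda>t. of_nat (g t) * indicator S t :: ennreal)"
    using assms(2) by (auto simp: fun_eq_iff indicator_def)
  finally show ?thesis by simp
qed

text \<open>Only above a positive scale is the structure finite: finitely many vertices, finitely many
  classes. Integrals over the half-line are approached from there.\<close>

lemma nn_integral_half_line_le:
  fixes h :: "real \<Rightarrow> ennreal"
  assumes meas: "(\<lambda>t. h t * indicator {0<..} t) \<in> borel_measurable lborel"
    and bound: "\<And>e. 0 < e \<Longrightarrow> (\<integral>\<^sup>+t\<in>{e<..}. h t \<partial>lborel) \<le> B"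
  shows "(\<integral>\<^sup>+t\<in>{0<..}. h t \<partial>lborel) \<le> B"
proof -
  define \<mu> where "\<mu> = density lborel (\<lambda>t. h t * indicator {0<..} t)"
  define A where "A n = {inverse (real (Suc n))<..}" for n
  have \<mu>: "emeasure \<mu> S = (\<integral>\<^sup>+t\<in>S. h t \<partial>lborel)" if "S \<in> sets borel" "S \<subseteq> {0<..}" for S
    unfolding \<mu>_def using that
    by (subst emeasure_density[OF meas]) (auto intro!: nn_integral_cong simp: indicator_def)
  define u where "u n = inverse (real (Suc n))" for n
  have u: "0 < u n" "u (Suc n) \<le> u n" for n
    unfolding u_def by (simp, intro le_imp_inverse_le) auto
  have A_u: "A n = {u n<..}" for n by (simp add: A_def u_def)
  have A: "(\<Union>n. A n) = {0<..}"
  proof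
    show "(\<Union>n. A n) \<subseteq> {0<..}"
    proof
      fix x assume "x \<in> (\<Union>n. A n)"
      then obtain n where "u n < x" by (auto simp: A_u)
      with u(1)[of n] show "x \<in> {0<..}" by simp
    qed
    show "{0<..} \<subseteq> (\<Union>n. A n)" using reals_Archimedean by (auto simp: A_def)
  qed
  have "A n \<subseteq> A (Suc n)" for n
    unfolding A_u using u(2)[of n] by auto
  then have "incseq A" unfolding incseq_Suc_iff by blast
  moreover have A_meas: "A n \<in> sets borel" for n by (simp add: A_u)
  ultimately have "emeasure \<mu> {0<..} = (SUP n. emeasure \<mu> (A n))"
    unfolding A[symmetric]
    by (intro SUP_emeasure_incseq[symmetric]) (auto simp: \<mu>_def image_subset_iff A_meas)
  also have "\<dots> \<le> B"
  proof (rule SUP_least)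
    fix n
    have "A n \<subseteq> {0<..}" using A by auto
    then show "emeasure \<mu> (A n) \<le> B" using bound[of "inverse (real (Suc n))"] \<mu>[of "A n"] by (simp add: A_def)
  qed
  finally show ?thesis by (simp add: \<mu>)
qed

lemma nn_integral_near_zero_small:
  fixes h :: "real \<Rightarrow> ennreal"
  assumes meas: "(\<lambda>t. h t * indicator {0<..} t) \<in> borel_measurable lborel"
    and finite: "(\<integral>\<^sup>+t\<in>{0<..}. h t \<partial>lborel) < \<infinity>" and "0 < \<delta>"
  obtains e where "0 < e" "(\<integral>\<^sup>+t\<in>{0<..e}. h t \<partial>lborel) < \<delta>"
proof -
  define \<mu> where "\<mu> = density lborel (\<lambda>t. h t * indicator {0<..} t)"
  define A where "A n = {0<..inverse (real (Suc n))}" for n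
  have \<mu>: "emeasure \<mu> S = (\<integral>\<^sup>+t\<in>S. h t \<partial>lborel)" if "S \<in> sets borel" "S \<subseteq> {0<..}" for S
    unfolding \<mu>_def using that
    by (subst emeasure_density[OF meas]) (auto intro!: nn_integral_cong simp: indicator_def)
  have "(\<Inter>n. A n) = {}"
    unfolding A_def using reals_Archimedean by (fastforce simp: not_le[symmetric])
  moreover have "A (Suc n) \<subseteq> A n" for n
  proof -
    have "inverse (real (Suc (Suc n))) \<le> inverse (real (Suc n))" by (intro le_imp_inverse_le) auto
    then show ?thesis unfolding A_def by (metis Ioc_subset_iff order_refl)
  qed
  then have "decseq A" unfolding decseq_Suc_iff by blast
  moreover have "emeasure \<mu> (A n) \<noteq> \<infinity>" for n
  proof -
    have "emeasure \<mu> (A n) \<le> emeasure \<mu> {0<..}" by (intro emeasure_mono) (auto simp: A_def \<mu>_def)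
    also have "\<dots> < \<infinity>" using finite by (simp add: \<mu>)
    finally show ?thesis by simp
  qed
  moreover have "range A \<subseteq> sets \<mu>" by (auto simp: \<mu>_def A_def)
  ultimately have "(INF n. emeasure \<mu> (A n)) = 0"
    using INF_emeasure_decseq[of A \<mu>] by simp
  then obtain n where "emeasure \<mu> (A n) < \<delta>"
    using \<open>0 < \<delta>\<close> by (metis INF_less_iff)
  moreover have "A n \<in> sets borel" "A n \<subseteq> {0<..}" by (auto simp: A_def)
  ultimately have "(\<integral>\<^sup>+t\<in>A n. h t \<partial>lborel) < \<delta>" by (simp add: \<mu>)
  then show ?thesis by (intro that[of "inverse (real (Suc n))"]) (auto simp: A_def)
qed

text \<open>As a function of the scale \<open>t\<close>, a jump of size \<open>r\<close> is represented by the indicator of \<open>t < r\<close>,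
  which integrates to \<open>r\<close>.\<close>

lemma gap_measurable:
  "S \<subseteq> {0<..} \<Longrightarrow> S \<in> sets borel \<Longrightarrow>
    (\<lambda>t. of_nat (if t < r then 1 else 0) * indicator S t :: ennreal) \<in> borel_measurable lborel"
  for r :: real
  by (intro antitone_nat_borel_measurable) auto

lemma nn_integral_indicator_below:
  assumes "0 \<le> r"
  shows "(\<integral>\<^sup>+t\<in>{0<..}. of_nat (if t < r then 1 else 0) \<partial>lborel) = ennreal r"
proof -
  have "(\<integral>\<^sup>+t\<in>{0<..}. of_nat (if t < r then 1 else 0) \<partial>lborel) = (\<integral>\<^sup>+t. indicator {0<..<r} t \<partial>lborel)"
    by (intro nn_integral_cong) (auto simp: indicator_def)
  then show ?thesis using assms by simp
qed

section \<open>Classes of a compact ultrametric and convex orders\<close>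

text \<open>The only use of compactness is the last assumption: balls whose radii vary from point to point
  have a finite subcover. Constant radii give finiteness of class numbers, varying radii the extreme
  points of \<open>last_exists\<close>. Distinct points may have distance \<open>0\<close>.\<close>

locale compact_ultrametric =
  fixes X :: "'a set" and c :: "'a \<Rightarrow> 'a \<Rightarrow> real"
  assumes refl: "x \<in> X \<Longrightarrow> c x x = 0"
    and sym: "x \<in> X \<Longrightarrow> y \<in> X \<Longrightarrow> c x y = c y x"
    and ultra: "x \<in> X \<Longrightarrow> y \<in> X \<Longrightarrow> z \<in> X \<Longrightarrow> c x z \<le> max (c x y) (c y z)"
    and finite_net: "(\<And>x. x \<in> X \<Longrightarrow> 0 < e x) \<Longrightarrow> \<exists>K. finite K \<and> K \<subseteq> X \<and> (\<forall>y\<in>X. \<exists>x\<in>K. c x y < e x)"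
begin

lemma nonneg: "x \<in> X \<Longrightarrow> y \<in> X \<Longrightarrow> 0 \<le> c x y"
  using ultra[of x y x] refl[of x] sym[of x y] by auto

definition cls :: "real \<Rightarrow> 'a \<Rightarrow> 'a set" where
  "cls t x = {y \<in> X. c x y \<le> t}"

lemma cls_eq_iff:
  assumes "x \<in> X" "y \<in> X" "0 \<le> t"
  shows "cls t x = cls t y \<longleftrightarrow> c x y \<le> t"
proof
  assume "cls t x = cls t y"
  moreover have "y \<in> cls t y" using assms refl by (simp add: cls_def)
  ultimately show "c x y \<le> t" by (auto simp: cls_def)
next
  assume "c x y \<le> t"
  then have "c x z \<le> t \<longleftrightarrow> c y z \<le> t" if "z \<in> X" for z
    using ultra[of x y z] ultra[of y x z] sym[of x y] assms that by auto
  then show "cls t x = cls t y" by (auto simp: cls_def)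
qed

lemma finite_cls:
  assumes "0 < t" "S \<subseteq> X"
  shows "finite (cls t ` S)"
proof -
  obtain K where K: "finite K" "K \<subseteq> X" "\<forall>y\<in>X. \<exists>x\<in>K. c x y < t"
    using finite_net[of "\<lambda>_. t"] assms by auto
  have "cls t ` S \<subseteq> cls t ` K"
  proof
    fix C assume "C \<in> cls t ` S"
    then obtain y where y: "y \<in> X" "C = cls t y" using assms by auto
    with K obtain x where "x \<in> K" "c x y < t" by auto
    then have "cls t x = cls t y" using K y assms by (subst cls_eq_iff) auto
    then show "C \<in> cls t ` K" using y \<open>x \<in> K\<close> by auto
  qed
  then show ?thesis using K by (meson finite_imageI finite_subset)
qed

text \<open>A class at scale \<open>t\<close> is determined by any class at the finer scale \<open>s\<close> that it contains.\<close>

lemma card_cls_antimono: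
  assumes "0 < s" "s \<le> t" "S \<subseteq> S'" "S' \<subseteq> X"
  shows "card (cls t ` S) \<le> card (cls s ` S')"
proof -
  have "cls t x = (\<Union>y\<in>cls s x. cls t y)" if "x \<in> S" for x
  proof -
    have "cls t y = cls t x" if "y \<in> cls s x" for y
      using that assms \<open>x \<in> S\<close> sym[of x y] by (subst cls_eq_iff) (auto simp: cls_def)
    moreover have "x \<in> cls s x" using assms refl \<open>x \<in> S\<close> by (auto simp: cls_def)
    ultimately show ?thesis by blast
  qed
  then have "cls t ` S = (\<lambda>C. \<Union>y\<in>C. cls t y) ` cls s ` S" by (auto simp: image_image)
  then have "card (cls t ` S) \<le> card (cls s ` S)"
    using finite_cls[of s S] assms by (metis card_image_le order_trans)
  also have "\<dots> \<le> card (cls s ` S')"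
    using finite_cls[of s S'] assms by (intro card_mono) auto
  finally show ?thesis .
qed

definition class_integral :: ennreal where
  "class_integral = (\<integral>\<^sup>+t\<in>{0<..}. of_nat (card (cls t ` X) - 1) \<partial>lborel)"

lemma card_cls_measurable:
  "S \<subseteq> {0<..} \<Longrightarrow> S \<in> sets borel \<Longrightarrow>
    (\<lambda>t. of_nat (card (cls t ` X) - 1) * indicator S t :: ennreal) \<in> borel_measurable lborel"
  by (intro antitone_nat_borel_measurable diff_le_mono card_cls_antimono) auto

end

section \<open>Convex orders\<close>

locale convex_ultrametric_order = compact_ultrametric +
  fixes le :: "'a \<Rightarrow> 'a \<Rightarrow> bool"
  assumes total: "x \<in> X \<Longrightarrow> y \<in> X \<Longrightarrow> le x y \<or> le y x"
    and trans: "x \<in> X \<Longrightarrow> y \<in> X \<Longrightarrow> z \<in> X \<Longrightarrow> le x y \<Longrightarrow> le y z \<Longrightarrow> le x z"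
    and convex: "x \<in> X \<Longrightarrow> y \<in> X \<Longrightarrow> z \<in> X \<Longrightarrow> le x y \<Longrightarrow> le y z \<Longrightarrow> c x z = max (c x y) (c y z)"
begin

definition left :: "real \<Rightarrow> 'a \<Rightarrow> 'a set" where
  "left t x = {z \<in> X. le z x \<and> t < c z x}"

definition rank :: "real \<Rightarrow> 'a \<Rightarrow> nat" where
  "rank t x = card (cls t ` left t x)"

lemma left_subset: "left t x \<subseteq> X"
  by (auto simp: left_def)

lemma left_mono: "x \<in> X \<Longrightarrow> y \<in> X \<Longrightarrow> le x y \<Longrightarrow> left t x \<subseteq> left t y"
  unfolding left_def using trans[of _ x y] convex[of _ x y] by auto

lemma cls_notin_left: "x \<in> X \<Longrightarrow> 0 < t \<Longrightarrow> cls t x \<notin> cls t ` left t x"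
  by (auto simp: left_def cls_eq_iff sym)

lemma rank_mono: "x \<in> X \<Longrightarrow> y \<in> X \<Longrightarrow> le x y \<Longrightarrow> 0 < t \<Longrightarrow> rank t x \<le> rank t y"
  unfolding rank_def by (intro card_cls_antimono left_mono left_subset) auto

lemma rank_antimono:
  assumes "x \<in> X" "0 < s" "s \<le> t"
  shows "rank t x \<le> rank s x"
  unfolding rank_def using assms by (intro card_cls_antimono left_subset) (auto simp: left_def)

lemma rank_measurable:
  "x \<in> X \<Longrightarrow> S \<subseteq> {0<..} \<Longrightarrow> S \<in> sets borel \<Longrightarrow>
    (\<lambda>t. of_nat (rank t x) * indicator S t :: ennreal) \<in> borel_measurable lborel"
  by (intro antitone_nat_borel_measurable rank_antimono) auto

text \<open>The class of \<open>x\<close> itself is counted for \<open>y\<close> and not for \<open>x\<close>.\<close>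

lemma rank_strict_mono:
  assumes "x \<in> X" "y \<in> X" "le x y" "0 < t" "t < c x y"
  shows "rank t x < rank t y"
proof -
  have "insert (cls t x) (cls t ` left t x) \<subseteq> cls t ` left t y"
    using left_mono[of x y t] assms by (auto simp: left_def)
  then have "card (insert (cls t x) (cls t ` left t x)) \<le> rank t y"
    unfolding rank_def by (intro card_mono finite_cls left_subset assms)
  then show ?thesis
    using assms by (simp add: rank_def cls_notin_left finite_cls left_subset)
qed

text \<open>The class of \<open>x\<close> itself is never counted, which accounts for the subtraction of one.\<close>

lemma rank_le:
  assumes "x \<in> X" "0 < t"
  shows "rank t x \<le> card (cls t ` X) - 1"
proof -
  have "insert (cls t x) (cls t ` left t x) \<subseteq> cls t ` X"
    using assms left_subset by auto
  then have "card (insert (cls t x) (cls t ` left t x)) \<le> card (cls t ` X)"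
    by (intro card_mono finite_cls assms) auto
  then show ?thesis
    using assms by (simp add: rank_def cls_notin_left finite_cls left_subset)
qed

lemma rank_of_last:
  assumes "b \<in> X" "0 < t" "\<And>z. z \<in> X \<Longrightarrow> le b z \<Longrightarrow> c b z = 0"
  shows "card (cls t ` X) - 1 \<le> rank t b"
proof -
  have "cls t z \<in> insert (cls t b) (cls t ` left t b)" if "z \<in> X" for z
  proof (cases "c z b \<le> t")
    case True
    then show ?thesis using that assms by (simp add: cls_eq_iff)
  next
    case False
    then have "\<not> le b z" using assms(2) assms(3)[OF that] sym[OF that assms(1)] by auto
    then show ?thesis using total[OF that assms(1)] False that by (auto simp: left_def)
  qed
  then have "card (cls t ` X) \<le> card (insert (cls t b) (cls t ` left t b))"
    using assms by (intro card_mono) (auto simp: finite_cls left_subset)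
  also have "\<dots> = Suc (rank t b)"
    using assms by (simp add: rank_def cls_notin_left finite_cls left_subset)
  finally show ?thesis by simp
qed

definition adjacent :: "real \<Rightarrow> 'a \<Rightarrow> 'a \<Rightarrow> bool" where
  "adjacent e x y \<longleftrightarrow> (\<forall>z\<in>X. le x z \<longrightarrow> le z y \<longrightarrow> c x z \<le> e \<or> c z y \<le> e)"

text \<open>A class counted for \<open>y\<close> and not for \<open>x\<close> contains a point between the two, which is close to \<open>x\<close>;
  so it is the class of \<open>x\<close>, and this one is counted for \<open>y\<close> only if it differs from the class of \<open>y\<close>.\<close>

lemma rank_adjacent:
  assumes "x \<in> X" "y \<in> X" "le x y" "adjacent e x y" "0 < e" "e \<le> t"
  shows "rank t y \<le> rank t x + (if t < c x y then 1 else 0)"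
proof -
  have near: "c x z \<le> t" if "z \<in> left t y" "le x z" for z
    using assms that by (force simp: adjacent_def left_def)
  have sub: "cls t z \<in> insert (cls t x) (cls t ` left t x)" if "z \<in> left t y" for z
  proof (cases "c z x \<le> t")
    case True
    then show ?thesis using that assms by (simp add: left_def cls_eq_iff)
  next
    case False
    then have "\<not> le x z" using near[OF that] that assms sym[of x z] by (auto simp: left_def)
    then show ?thesis using total[of x z] False that assms by (auto simp: left_def)
  qed
  show ?thesis
  proof (cases "t < c x y")
    case True
    have "rank t y \<le> card (insert (cls t x) (cls t ` left t x))"
      unfolding rank_def using sub assms by (intro card_mono) (auto simp: finite_cls left_subset)
    then show ?thesis
      using True assms by (simp add: rank_def cls_notin_left finite_cls left_subset)
  next
    case False
    have "z \<in> left t x" if z: "z \<in> left t y" for z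
    proof -
      have "\<not> c x z \<le> t"
        using z False ultra[of z x y] sym[of x z] assms by (auto simp: left_def)
      then show ?thesis using near[OF z] total[of x z] z assms sym[of x z] by (auto simp: left_def)
    qed
    then have "rank t y \<le> rank t x"
      unfolding rank_def using assms by (intro card_cls_antimono left_subset) auto
    then show ?thesis by simp
  qed
qed

text \<open>A pair that is not adjacent is split at a point far from both ends. The difference of
  the ranks at scale \<open>e\<close> drops on both sides, so this terminates and reduces a transitive
  property to adjacent pairs.\<close>

lemma split_induct [consumes 4, case_names adjacent split]:
  assumes "0 < e" "x \<in> X" "y \<in> X" "le x y"
    and base: "\<And>x y. x \<in> X \<Longrightarrow> y \<in> X \<Longrightarrow> le x y \<Longrightarrow> adjacent e x y \<Longrightarrow> P x y"
    and step: "\<And>x y z. x \<in> X \<Longrightarrow> y \<in> X \<Longrightarrow> z \<in> X \<Longrightarrow> le x z \<Longrightarrow> le z y \<Longrightarrow> P x z \<Longrightarrow> P z y \<Longrightarrow> P x y"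
  shows "P x y"
  using assms(2-4)
proof (induction "rank e y - rank e x" arbitrary: x y rule: less_induct)
  case less
  show ?case
  proof (cases "adjacent e x y")
    case False
    then obtain z where z: "z \<in> X" "le x z" "le z y" "e < c x z" "e < c z y"
      by (auto simp: adjacent_def not_le)
    have "rank e x < rank e z" "rank e z < rank e y"
      using less.prems z \<open>0 < e\<close> by (auto intro: rank_strict_mono)
    then have "P x z" "P z y" using less.prems z by (auto intro!: less.hyps)
    then show ?thesis using less.prems z by (auto intro: step)
  qed (use base less.prems in auto)
qed


lemma dual_order: "convex_ultrametric_order X c (\<lambda>x y. le y x)"
proof unfold_locales
  fix x y z assume *: "x \<in> X" "y \<in> X" "z \<in> X" "le y x" "le z y"
  show "le z x" using * trans by blast
  show "c x z = max (c x y) (c y z)" using * convex[of z y x] sym[of x y] sym[of x z] sym[of y z] by simp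
qed (rule total)

lemma finite_set_has_last:
  assumes "finite Z" "Z \<noteq> {}" "Z \<subseteq> X"
  shows "\<exists>m\<in>Z. \<forall>z\<in>Z. le z m"
  using assms
proof (induction rule: finite_ne_induct)
  case (singleton z)
  then show ?case using total by auto
next
  case (insert z Z)
  then obtain m where m: "m \<in> Z" "\<forall>z\<in>Z. le z m" by auto
  then have X: "z \<in> X" "m \<in> X" using insert.prems by auto
  show ?case
  proof (cases "le z m")
    case True
    then show ?thesis using m by auto
  next
    case False
    then have "le m z" using total X by blast
    then have "le w z" if "w \<in> Z" for w using trans[of w m z] m that X insert.prems by blast
    then show ?thesis using total[OF X(1) X(1)] by auto
  qed
qed

text \<open>Suppose every \<open>x\<close> had a point \<open>g x\<close> to its right at positive distance. The balls around \<open>x\<close> of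
  radius \<open>c x (g x)\<close> have a finite subcover, and the rightmost of the finitely many \<open>g k\<close> lies in one
  of these balls; but by convexity it is too far away from the centre. The result says that a compact
  space has a last point up to distance \<open>0\<close>, even if the order has no greatest element.\<close>

lemma last_exists:
  assumes "X \<noteq> {}"
  obtains b where "b \<in> X" "\<And>z. z \<in> X \<Longrightarrow> le b z \<Longrightarrow> c b z = 0"
proof -
  have "\<exists>b\<in>X. \<forall>z\<in>X. le b z \<longrightarrow> c b z = 0"
  proof (rule ccontr)
    assume "\<not> ?thesis"
    then have "\<forall>x\<in>X. \<exists>z. z \<in> X \<and> le x z \<and> c x z \<noteq> 0" by blast
    then obtain g where g: "\<forall>x\<in>X. g x \<in> X \<and> le x (g x) \<and> c x (g x) \<noteq> 0"
      unfolding bchoice_iff by blast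
    then have "0 < c x (g x)" if "x \<in> X" for x using nonneg[of x "g x"] that by force
    then obtain K where K: "finite K" "K \<subseteq> X" "\<forall>y\<in>X. \<exists>x\<in>K. c x y < c x (g x)"
      using finite_net[of "\<lambda>x. c x (g x)"] by auto
    then have "K \<noteq> {}" using assms by blast
    moreover have "g ` K \<subseteq> X" using K(2) g by blast
    ultimately obtain m where m: "m \<in> K" "\<forall>k\<in>K. le (g k) (g m)"
      using finite_set_has_last[of "g ` K"] K(1) by auto
    have "g m \<in> X" using m(1) K(2) g by blast
    then obtain k where k: "k \<in> K" "c k (g m) < c k (g k)" using K(3) by blast
    then have "k \<in> X" using K(2) by blast
    then have "c k (g m) = max (c k (g k)) (c (g k) (g m))"
      using g m(2) k(1) \<open>g m \<in> X\<close> by (intro convex) auto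
    then show False using k(2) by simp
  qed
  then show ?thesis using that by metis
qed

lemma rank_of_first:
  assumes "a \<in> X" "0 < t" "\<And>z. z \<in> X \<Longrightarrow> le z a \<Longrightarrow> c a z = 0"
  shows "rank t a = 0"
proof -
  have "left t a = {}" using assms by (force simp: left_def sym)
  then show ?thesis by (simp add: rank_def)
qed

text \<open>If the first point chosen lies to the right of the last point chosen, then it is itself last, and
  the two can be taken equal.\<close>

lemma first_and_last_exist:
  assumes "X \<noteq> {}"
  obtains a b where "a \<in> X" "b \<in> X" "le a b"
    "\<And>t. 0 < t \<Longrightarrow> rank t a = 0" "\<And>t. 0 < t \<Longrightarrow> card (cls t ` X) - 1 \<le> rank t b"
proof -
  interpret dual: convex_ultrametric_order X c "\<lambda>x y. le y x" by (rule dual_order)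
  obtain a where a: "a \<in> X" "\<And>z. z \<in> X \<Longrightarrow> le z a \<Longrightarrow> c a z = 0"
    by (rule dual.last_exists[OF assms]) blast
  obtain b where b: "b \<in> X" "\<And>z. z \<in> X \<Longrightarrow> le b z \<Longrightarrow> c b z = 0"
    by (rule last_exists[OF assms]) blast
  note rank_a = rank_of_first[OF a(1) _ a(2)]
  show ?thesis
  proof (cases "le a b")
    case True
    from that[OF a(1) b(1) this rank_a rank_of_last[OF b(1) _ b(2)]] show ?thesis .
  next
    case False
    then have ba: "le b a" using total[OF a(1) b(1)] by simp
    have last: "c a z = 0" if "z \<in> X" "le a z" for z
    proof -
      have "c b z = 0" using b(2) that trans[OF b(1) a(1) that(1) ba that(2)] by simp
      moreover have "c b z = max (c b a) (c a z)" using b(1) a(1) that(1) ba that(2) by (rule convex)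
      ultimately show ?thesis using nonneg[OF a(1) that(1)] by linarith
    qed
    have "le a a" using total[OF a(1) a(1)] by simp
    from that[OF a(1) a(1) this rank_a rank_of_last[OF a(1) _ last]] show ?thesis .
  qed
qed

section \<open>The class integral bounds the span of an expanding map from below\<close>

text \<open>The ranks grow from \<open>0\<close> at the first point to \<open>N(t) - 1\<close> at the last one, and the integral of this
  growth over the scales above \<open>e\<close> is at most the growth of \<open>f\<close>. For adjacent points this
  integral is at most \<open>c x y\<close>, and so at most \<open>f y - f x\<close>; the bound adds up along splittings.\<close>

lemma class_integral_le_span:
  assumes expand: "\<And>x y. x \<in> X \<Longrightarrow> y \<in> X \<Longrightarrow> le x y \<Longrightarrow> c x y \<le> f y - f x" and "X \<noteq> {}"
  shows "\<exists>a\<in>X. \<exists>b\<in>X. class_integral \<le> ennreal (f b - f a)"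
proof -
  obtain a b where ab: "a \<in> X" "b \<in> X" "le a b"
    "\<And>t. 0 < t \<Longrightarrow> rank t a = 0" "\<And>t. 0 < t \<Longrightarrow> card (cls t ` X) - 1 \<le> rank t b"
    using first_and_last_exist[OF assms(2)] by metis
  have "class_integral \<le> ennreal (f b - f a)"
    unfolding class_integral_def
  proof (rule nn_integral_half_line_le)
    fix e :: real assume "0 < e"
    have "(\<integral>\<^sup>+t\<in>{e<..}. of_nat (rank t b) \<partial>lborel) \<le>
        (\<integral>\<^sup>+t\<in>{e<..}. of_nat (rank t a) \<partial>lborel) + ennreal (f b - f a)"
      using \<open>0 < e\<close> ab(1-3)
    proof (induction rule: split_induct)
      case (adjacent x y)
      let ?gap = "\<lambda>t. if t < c x y then 1 else 0 :: nat"
      have "(\<integral>\<^sup>+t\<in>{e<..}. of_nat (rank t y) \<partial>lborel) \<le>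
          (\<integral>\<^sup>+t. of_nat (rank t x) * indicator {e<..} t + of_nat (?gap t) * indicator {e<..} t \<partial>lborel)"
      proof (intro nn_integral_mono)
        fix t
        have "of_nat (rank t y) \<le> (of_nat (rank t x + ?gap t) :: ennreal)" if "e < t"
          using rank_adjacent[of x y e t] adjacent that \<open>0 < e\<close> by (subst of_nat_le_iff) auto
        then show "of_nat (rank t y) * indicator {e<..} t \<le>
            (of_nat (rank t x) * indicator {e<..} t + of_nat (?gap t) * indicator {e<..} t :: ennreal)"
          by (auto simp: indicator_def)
      qed
      also have "\<dots> = (\<integral>\<^sup>+t\<in>{e<..}. of_nat (rank t x) \<partial>lborel) + (\<integral>\<^sup>+t\<in>{e<..}. of_nat (?gap t) \<partial>lborel)"
        using adjacent \<open>0 < e\<close> by (intro nn_integral_add gap_measurable rank_measurable) auto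
      also have "(\<integral>\<^sup>+t\<in>{e<..}. of_nat (?gap t) \<partial>lborel) \<le> (\<integral>\<^sup>+t\<in>{0<..}. of_nat (?gap t) \<partial>lborel)"
        using \<open>0 < e\<close> by (intro nn_integral_mono) (auto simp: indicator_def)
      also have "\<dots> = ennreal (c x y)" using adjacent by (intro nn_integral_indicator_below nonneg)
      also have "\<dots> \<le> ennreal (f y - f x)" using adjacent expand by (intro ennreal_leI) auto
      finally show ?case by (simp add: add_left_mono)
    next
      case (split x y z)
      have "c x z \<le> f z - f x" "c z y \<le> f y - f z" "0 \<le> c x z" "0 \<le> c z y"
        using split expand nonneg by auto
      then have "ennreal (f y - f x) = ennreal (f z - f x) + ennreal (f y - f z)"
        by (subst ennreal_plus[symmetric]) auto
      then show ?case
        using order_trans[OF split.IH(2) add_right_mono[OF split.IH(1)]] by (simp add: add.assoc)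
    qed
    also have "(\<integral>\<^sup>+t\<in>{e<..}. of_nat (rank t a) \<partial>lborel) = (\<integral>\<^sup>+(t :: real). 0 \<partial>lborel)"
      using ab(4) \<open>0 < e\<close> by (intro nn_integral_cong) (auto simp: indicator_def)
    finally have "(\<integral>\<^sup>+t\<in>{e<..}. of_nat (rank t b) \<partial>lborel) \<le> ennreal (f b - f a)" by simp
    moreover have "(\<integral>\<^sup>+t\<in>{e<..}. of_nat (card (cls t ` X) - 1) \<partial>lborel) \<le> (\<integral>\<^sup>+t\<in>{e<..}. of_nat (rank t b) \<partial>lborel)"
    proof (intro nn_integral_mono)
      fix t
      have "(of_nat (card (cls t ` X) - 1) :: ennreal) \<le> of_nat (rank t b)" if "e < t"
        unfolding of_nat_le_iff using ab(5) that \<open>0 < e\<close> by auto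
      then show "of_nat (card (cls t ` X) - 1) * indicator {e<..} t
          \<le> (of_nat (rank t b) * indicator {e<..} t :: ennreal)"
        by (simp add: indicator_def)
    qed
    ultimately show "(\<integral>\<^sup>+t\<in>{e<..}. of_nat (card (cls t ` X) - 1) \<partial>lborel) \<le> ennreal (f b - f a)"
      by (rule order_trans[rotated])
  next
    show "(\<lambda>t. of_nat (card (cls t ` X) - 1) * indicator {0<..} t :: ennreal) \<in> borel_measurable lborel"
      by (rule card_cls_measurable) auto
  qed
  then show ?thesis using ab(1,2) by blast
qed

section \<open>The map to the line given by a convex order\<close>

definition rank_integral :: "'a \<Rightarrow> ennreal" where
  "rank_integral x = (\<integral>\<^sup>+t\<in>{0<..}. of_nat (rank t x) \<partial>lborel)"

definition position :: "'a \<Rightarrow> real" where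
  "position x = enn2real (rank_integral x)"

lemma rank_integral_le:
  assumes "x \<in> X"
  shows "rank_integral x \<le> class_integral"
  unfolding rank_integral_def class_integral_def
proof (intro nn_integral_mono)
  fix t
  have "(of_nat (rank t x) :: ennreal) \<le> of_nat (card (cls t ` X) - 1)" if "0 < t"
    unfolding of_nat_le_iff using assms that by (rule rank_le)
  then show "of_nat (rank t x) * indicator {0<..} t
      \<le> (of_nat (card (cls t ` X) - 1) * indicator {0<..} t :: ennreal)"
    by (simp add: indicator_def)
qed

lemma rank_integral_expands:
  assumes "x \<in> X" "y \<in> X" "le x y"
  shows "rank_integral x + ennreal (c x y) \<le> rank_integral y"
proof -
  let ?gap = "\<lambda>t. if t < c x y then 1 else 0 :: nat"
  have "rank_integral x + ennreal (c x y) =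
      (\<integral>\<^sup>+t\<in>{0<..}. of_nat (rank t x) \<partial>lborel) + (\<integral>\<^sup>+t\<in>{0<..}. of_nat (?gap t) \<partial>lborel)"
    using assms by (subst nn_integral_indicator_below) (auto simp: rank_integral_def nonneg)
  also have "\<dots> = (\<integral>\<^sup>+t. of_nat (rank t x) * indicator {0<..} t + of_nat (?gap t) * indicator {0<..} t \<partial>lborel)"
    using assms by (intro nn_integral_add[symmetric] gap_measurable rank_measurable) auto
  also have "\<dots> \<le> rank_integral y"
    unfolding rank_integral_def
  proof (intro nn_integral_mono)
    fix t
    have "(of_nat (rank t x + ?gap t) :: ennreal) \<le> of_nat (rank t y)" if "0 < t"
      using rank_mono[of x y t] rank_strict_mono[of x y t] assms that by (subst of_nat_le_iff) auto
    then show "(of_nat (rank t x) * indicator {0<..} t + of_nat (?gap t) * indicator {0<..} t :: ennreal)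
        \<le> of_nat (rank t y) * indicator {0<..} t"
      by (auto simp: indicator_def)
  qed
  finally show ?thesis .
qed

text \<open>At scales above \<open>e\<close> the rank jumps only below \<open>c x y\<close>, and by one; at the scales up to \<open>e\<close> the crude
  bound \<open>N(t) - 1\<close> of any rank suffices.\<close>

lemma rank_integral_adjacent:
  assumes "x \<in> X" "y \<in> X" "le x y" "adjacent e x y" "0 < e"
  shows "rank_integral y \<le>
    rank_integral x + (\<integral>\<^sup>+t\<in>{0<..e}. of_nat (card (cls t ` X) - 1) \<partial>lborel) + ennreal (c x y)"
proof -
  let ?gap = "\<lambda>t. if t < c x y then 1 else 0 :: nat" and ?N = "\<lambda>t. card (cls t ` X) - 1"
  have "rank_integral y \<le> (\<integral>\<^sup>+t. of_nat (rank t x) * indicator {0<..} t +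
      of_nat (?N t) * indicator {0<..e} t + of_nat (?gap t) * indicator {0<..} t \<partial>lborel)"
    unfolding rank_integral_def
  proof (intro nn_integral_mono)
    fix t
    have "of_nat (rank t y) \<le> (of_nat (rank t x + ?gap t) :: ennreal)" if "e \<le> t"
      using rank_adjacent[of x y e t] assms that by (subst of_nat_le_iff) auto
    moreover have "of_nat (rank t y) \<le> (of_nat (rank t x + ?N t + ?gap t) :: ennreal)" if "0 < t" "t \<le> e"
      using rank_le[of y t] assms that by (subst of_nat_le_iff) auto
    ultimately show "of_nat (rank t y) * indicator {0<..} t \<le> (of_nat (rank t x) * indicator {0<..} t +
      of_nat (?N t) * indicator {0<..e} t + of_nat (?gap t) * indicator {0<..} t :: ennreal)"
      using \<open>0 < e\<close> by (auto simp: indicator_def simp del: of_nat_diff)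
  qed
  also have "\<dots> = (\<integral>\<^sup>+t. of_nat (rank t x) * indicator {0<..} t +
      of_nat (?N t) * indicator {0<..e} t \<partial>lborel) + (\<integral>\<^sup>+t\<in>{0<..}. of_nat (?gap t) \<partial>lborel)"
    using assms by (intro nn_integral_add borel_measurable_add gap_measurable rank_measurable card_cls_measurable) auto
  also have "(\<integral>\<^sup>+t. of_nat (rank t x) * indicator {0<..} t + of_nat (?N t) * indicator {0<..e} t \<partial>lborel)
      = rank_integral x + (\<integral>\<^sup>+t\<in>{0<..e}. of_nat (?N t) \<partial>lborel)"
    unfolding rank_integral_def using assms by (intro nn_integral_add rank_measurable card_cls_measurable) auto
  also have "(\<integral>\<^sup>+t\<in>{0<..}. of_nat (?gap t) \<partial>lborel) = ennreal (c x y)"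
    using assms by (intro nn_integral_indicator_below nonneg)
  finally show ?thesis .
qed

context
  assumes finite_integral: "class_integral < \<infinity>"
begin

lemma ennreal_position: "x \<in> X \<Longrightarrow> ennreal (position x) = rank_integral x"
  unfolding position_def using rank_integral_le[of x] finite_integral
  by (intro ennreal_enn2real) (auto intro: le_less_trans)

lemma position_le: "x \<in> X \<Longrightarrow> position x \<le> enn2real class_integral"
  unfolding position_def using rank_integral_le[of x] finite_integral
  by (intro enn2real_mono) auto

lemma position_nonneg: "0 \<le> position x"
  by (simp add: position_def)

lemma position_expands:
  assumes "x \<in> X" "y \<in> X" "le x y"
  shows "c x y \<le> position y - position x"
proof -
  have "ennreal (position x + c x y) \<le> ennreal (position y)"
    using rank_integral_expands[OF assms] assms
    by (simp add: ennreal_plus nonneg position_nonneg ennreal_position)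
  then show ?thesis using position_nonneg[of y] by (subst (asm) ennreal_le_iff) auto
qed

lemma abs_position_expands:
  assumes "x \<in> X" "y \<in> X"
  shows "c x y \<le> \<bar>position x - position y\<bar>"
  using position_expands[OF assms] position_expands[OF assms(2,1)] total[OF assms] sym[OF assms] by auto

lemma position_adjacent:
  assumes "0 < \<delta>"
  obtains e where "0 < e"
    "\<And>x y. x \<in> X \<Longrightarrow> y \<in> X \<Longrightarrow> le x y \<Longrightarrow> adjacent e x y \<Longrightarrow> position y - position x \<le> c x y + \<delta>"
proof -
  obtain e where e: "0 < e" "(\<integral>\<^sup>+t\<in>{0<..e}. of_nat (card (cls t ` X) - 1) \<partial>lborel) < ennreal \<delta>"
    using nn_integral_near_zero_small[of "\<lambda>t. of_nat (card (cls t ` X) - 1)" "ennreal \<delta>"]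
      card_cls_measurable[of "{0<..}"] finite_integral assms unfolding class_integral_def by auto
  have "position y - position x \<le> c x y + \<delta>" if "x \<in> X" "y \<in> X" "le x y" "adjacent e x y" for x y
  proof -
    have "ennreal (position y) \<le> rank_integral x + ennreal \<delta> + ennreal (c x y)"
      unfolding ennreal_position[OF that(2)]
      by (rule order_trans[OF rank_integral_adjacent[OF that \<open>0 < e\<close>]])
        (intro add_mono order_refl less_imp_le e)
    also have "\<dots> = ennreal (position x + \<delta> + c x y)"
      using assms that by (simp add: ennreal_plus nonneg position_nonneg ennreal_position)
    finally show ?thesis
      using assms that by (subst (asm) ennreal_le_iff) (auto simp: nonneg position_nonneg)
  qed
  with e show ?thesis using that by blast
qed

text \<open>A finite sequence of \<open>e\<close>-adjacent pairs leads from \<open>x\<close> to \<open>y\<close>, and convexity keeps all their distances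
  below \<open>c x y\<close>.\<close>

lemma position_chain:
  assumes "x \<in> X" "y \<in> X" "le x y" "0 < \<delta>"
  shows "(chain_step (position ` X) (\<lambda>s t. \<bar>s - t\<bar>) (c x y + \<delta>))\<^sup>*\<^sup>* (position x) (position y)"
proof -
  obtain e where e: "0 < e"
    "\<And>x y. x \<in> X \<Longrightarrow> y \<in> X \<Longrightarrow> le x y \<Longrightarrow> adjacent e x y \<Longrightarrow> position y - position x \<le> c x y + \<delta>"
    using position_adjacent[OF assms(4)] by metis
  from e(1) assms(1-3) show ?thesis
  proof (induction rule: split_induct)
    case (adjacent x y)
    then have "0 \<le> position y - position x" using position_expands[of x y] nonneg[of x y] by auto
    then show ?case using adjacent e(2)[of x y] by (intro r_into_rtranclp) (auto simp: chain_step_def)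
  next
    case (split x y z)
    have "c x z \<le> c x y" "c z y \<le> c x y" using split convex[of x z y] by auto
    with split.IH show ?case by (meson add_right_mono reachable_mono rtranclp_trans)
  qed
qed

text \<open>A step in the image is at least the distance in \<open>X\<close> of the two points that it joins, so the
  ultrametric inequality bounds \<open>c x y\<close> by the largest step of any chain in the image.\<close>

lemma chain_dist_position:
  assumes "x \<in> X" "y \<in> X"
  shows "chain_dist (position ` X) (\<lambda>s t. \<bar>s - t\<bar>) (position x) (position y) = c x y"
proof -
  let ?A = "position ` X"
  interpret R: Metric_space ?A "\<lambda>s t. \<bar>s - t\<bar>" by (rule Metric_space_real_subset)
  have le: "chain_dist ?A (\<lambda>s t. \<bar>s - t\<bar>) (position x) (position y) \<le> c x y"
    if "x \<in> X" "y \<in> X" "le x y" for x y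
  proof (rule field_le_epsilon)
    fix \<delta> :: real assume "0 < \<delta>"
    then show "chain_dist ?A (\<lambda>s t. \<bar>s - t\<bar>) (position x) (position y) \<le> c x y + \<delta>"
      using that nonneg[of x y] by (intro chain_dist_le position_chain) auto
  qed
  have reach: "c x y \<le> e"
    if "(chain_step ?A (\<lambda>s t. \<bar>s - t\<bar>) e)\<^sup>*\<^sup>* s u" "0 \<le> e" "s = position x" "u = position y" "y \<in> X" for e s u y
    using that
  proof (induction arbitrary: y rule: rtranclp_induct)
    case base
    then show ?case using abs_position_expands[of x y] assms by auto
  next
    case (step u v)
    then obtain z where z: "z \<in> X" "u = position z" by (auto simp: chain_step_def)
    then have "c x z \<le> e" using step by auto
    moreover have "c z y \<le> e"
      using abs_position_expands[of z y] step z by (auto simp: chain_step_def)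
    moreover have "c x y \<le> max (c x z) (c z y)" using ultra assms(1) z(1) step.prems(4) by blast
    ultimately show ?case by linarith
  qed
  have "c x y \<le> chain_dist ?A (\<lambda>s t. \<bar>s - t\<bar>) (position x) (position y)"
  proof (rule field_le_epsilon)
    fix \<delta> :: real assume "0 < \<delta>"
    let ?r = "chain_dist ?A (\<lambda>s t. \<bar>s - t\<bar>) (position x) (position y)"
    have "0 \<le> ?r" using assms by (intro R.chain_dist_nonneg) auto
    then show "c x y \<le> ?r + \<delta>"
      using \<open>0 < \<delta>\<close> assms
      by (intro reach[of "?r + \<delta>" "position x" "position y"] R.reachable_if_chain_dist_less) auto
  qed
  moreover have "chain_dist ?A (\<lambda>s t. \<bar>s - t\<bar>) (position x) (position y) \<le> c x y"
    using le[of x y] le[of y x] total[OF assms] assms sym[of x y]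
      R.chain_dist_commute[of "position x" "position y"] by auto
  ultimately show ?thesis by simp
qed

end

end

section \<open>Existence of convex orders\<close>

text \<open>Fix any linear order on sets. To compare \<open>x\<close> and \<open>y\<close>, compare the open balls around them of radius
  \<open>c x y\<close>, that is, the two different branches through which \<open>x\<close> and \<open>y\<close> leave their smallest common
  cluster. If one of \<open>c x y\<close> and \<open>c y z\<close> is larger, it decides the comparison of \<open>x\<close> and \<open>z\<close>; if they
  agree, antisymmetry keeps the branches of \<open>x\<close> and \<open>z\<close> distinct.\<close>

lemma (in compact_ultrametric) convex_order_exists: "\<exists>le. convex_ultrametric_order X c le"
proof -
  obtain R :: "('a set \<times> 'a set) set" where "well_order_on UNIV R" using well_order_on by blast
  then have R: "refl R" "trans R" "antisym R" "total R"
    by (auto simp: well_order_on_def linear_order_on_def partial_order_on_def preorder_on_def)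
  define B where "B r x = {y \<in> X. c x y < r}" for r x
  define le where "le x y \<longleftrightarrow> (B (c x y) x, B (c x y) y) \<in> R" for x y
  have B_eq: "B r x = B r y" if "x \<in> X" "y \<in> X" "c x y < r" for x y r
  proof -
    have "c x z < r \<longleftrightarrow> c y z < r" if "z \<in> X" for z
      using ultra[of x y z] ultra[of y x z] sym[of x y] \<open>x \<in> X\<close> \<open>y \<in> X\<close> \<open>c x y < r\<close> that by auto
    then show ?thesis by (auto simp: B_def)
  qed
  have tri: "le x z \<and> c x z = max (c x y) (c y z)"
    if X: "x \<in> X" "y \<in> X" "z \<in> X" and le: "le x y" "le y z" for x y z
  proof (cases "c x y" "c y z" rule: linorder_cases)
    case less
    then have "c x z = c y z"
      using ultra[of x y z] ultra[of y x z] sym[of x y] X by auto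
    then show ?thesis using less le B_eq[of x y "c y z"] X by (auto simp: le_def)
  next
    case greater
    then have "c x z = c x y"
      using ultra[of x y z] ultra[of x z y] sym[of y z] X by auto
    then show ?thesis using greater le B_eq[of y z "c x y"] X by (auto simp: le_def)
  next
    case equal
    define r where "r = c x y"
    have R': "(B r x, B r y) \<in> R" "(B r y, B r z) \<in> R" using le equal by (auto simp: le_def r_def)
    have "\<not> c x z < r"
    proof
      assume "c x z < r"
      then have "B r x = B r y" using B_eq[of x z r] X R' R(3) by (auto dest: antisymD)
      moreover have "y \<in> B r y" using X refl nonneg[of x z] \<open>c x z < r\<close> by (auto simp: B_def)
      ultimately show False by (auto simp: B_def r_def)
    qed
    then have "c x z = r" using ultra[of x y z] X equal by (auto simp: r_def)
    moreover have "(B r x, B r z) \<in> R" using R' R(2) by (meson transD)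
    ultimately show ?thesis using equal by (auto simp: le_def r_def)
  qed
  have "convex_ultrametric_order X c le"
  proof unfold_locales
    fix x y assume "x \<in> X" "y \<in> X"
    then have "c y x = c x y" by (rule sym[symmetric])
    moreover have "(B (c x y) x, B (c x y) y) \<in> R \<or> (B (c x y) y, B (c x y) x) \<in> R"
      using R(1,4) by (metis UNIV_I refl_onD total_on_def)
    ultimately show "le x y \<or> le y x" by (simp add: le_def)
  next
    fix x y z assume "x \<in> X" "y \<in> X" "z \<in> X" "le x y" "le y z"
    from tri[OF this] show "le x z" "c x z = max (c x y) (c y z)" by auto
  qed
  then show ?thesis by blast
qed

section \<open>Compact spaces\<close>

text \<open>By the ultrametric inequality, distances of at least \<open>t\<close> do not change when the end points are moved
  by less than \<open>t\<close>. So such distances occur already between points of a finite net, and there are only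
  finitely many of them.\<close>

lemma (in compact_ultrametric) max_distance_attained:
  assumes "Q \<subseteq> X" "Q \<noteq> {}"
  shows "\<exists>x\<in>Q. \<exists>y\<in>Q. \<forall>u\<in>Q. \<forall>v\<in>Q. c u v \<le> c x y"
proof (cases "\<exists>u\<in>Q. \<exists>v\<in>Q. 0 < c u v")
  case False
  obtain x where x: "x \<in> Q" using assms(2) by blast
  have "c u v \<le> c x x" if "u \<in> Q" "v \<in> Q" for u v
    using False that nonneg[of x x] x assms(1) by (force simp: not_less)
  then show ?thesis using x by blast
next
  case True
  then obtain x0 y0 where xy: "x0 \<in> Q" "y0 \<in> Q" "0 < c x0 y0" by blast
  define t where "t = c x0 y0"
  define V where "V = {c u v | u v. u \<in> Q \<and> v \<in> Q \<and> t \<le> c u v}"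
  obtain K where K: "finite K" "K \<subseteq> X" "\<forall>y\<in>X. \<exists>x\<in>K. c x y < t"
    using finite_net[of "\<lambda>_. t"] xy by (auto simp: t_def)
  have "V \<subseteq> (\<lambda>(a, b). c a b) ` (K \<times> K)"
  proof
    fix r assume "r \<in> V"
    then obtain u v where uv: "u \<in> X" "v \<in> X" "t \<le> c u v" "r = c u v"
      using assms(1) by (auto simp: V_def)
    then obtain a b where ab: "a \<in> K" "b \<in> K" "c a u < t" "c b v < t" using K(3) by blast
    then have X: "a \<in> X" "b \<in> X" using K(2) by auto
    have "c u v = c a v"
      using ultra[OF uv(1) X(1) uv(2)] ultra[OF X(1) uv(1,2)] sym[OF X(1) uv(1)] uv ab by linarith
    moreover have "c a v = c a b"
      using ultra[OF X(1) uv(2) X(2)] ultra[OF X uv(2)] sym[OF X(2) uv(2)] uv ab calculation by linarith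
    ultimately have "r = c a b" using uv by simp
    then show "r \<in> (\<lambda>(a, b). c a b) ` (K \<times> K)" using ab(1,2) by auto
  qed
  then have fin: "finite V" by (rule finite_subset) (use K(1) in simp)
  have "t \<in> V" using xy by (auto simp: V_def t_def)
  then have "Max V \<in> V" using fin by (intro Max_in) auto
  then obtain x y where "x \<in> Q" "y \<in> Q" "Max V = c x y" by (auto simp: V_def)
  moreover have "c u v \<le> Max V" if "u \<in> Q" "v \<in> Q" for u v
  proof (cases "t \<le> c u v")
    case True
    then show ?thesis using that fin by (intro Max_ge) (auto simp: V_def)
  next
    case False
    then show ?thesis using Max_ge[OF fin \<open>t \<in> V\<close>] by linarith
  qed
  ultimately show ?thesis by metis
qed

text \<open>Balls of the chain distance are open, since the chain distance is below the distance.\<close>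

lemma (in Metric_space) compact_ultrametric_chain_dist:
  assumes "compact_space mtopology"
  shows "compact_ultrametric M (chain_dist M d)"
proof
  fix e :: "'a \<Rightarrow> real" assume e: "\<And>x. x \<in> M \<Longrightarrow> 0 < e x"
  define U where "U x = {y \<in> M. chain_dist M d x y < e x}" for x
  have "openin mtopology (U x)" if "x \<in> M" for x
    unfolding openin_mtopology
  proof (intro conjI allI impI)
    show "U x \<subseteq> M" by (auto simp: U_def)
    fix y assume y: "y \<in> U x"
    have "mball y (e x) \<subseteq> U x"
    proof
      fix z assume "z \<in> mball y (e x)"
      then have z: "z \<in> M" "d y z < e x" by auto
      have "y \<in> M" using y by (simp add: U_def)
      then have "chain_dist M d x z \<le> max (chain_dist M d x y) (chain_dist M d y z)"
        "chain_dist M d y z \<le> d y z" using that z by (auto intro: chain_dist_ultra chain_dist_le_dist)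
      then show "z \<in> U x" using y z by (auto simp: U_def)
    qed
    then show "\<exists>r>0. mball y r \<subseteq> U x" using e[OF that] by blast
  qed
  moreover have "topspace mtopology \<subseteq> \<Union>(U ` M)"
    using e by (auto simp: U_def chain_dist_refl)
  ultimately obtain \<F> where \<F>: "finite \<F>" "\<F> \<subseteq> U ` M" "topspace mtopology \<subseteq> \<Union>\<F>"
    using assms unfolding compact_space_alt by (metis (no_types, lifting) imageE)
  then obtain K where "K \<subseteq> M" "finite K" "\<F> = U ` K" by (meson finite_subset_image)
  then show "\<exists>K. finite K \<and> K \<subseteq> M \<and> (\<forall>y\<in>M. \<exists>x\<in>K. chain_dist M d x y < e x)"
    using \<F>(3) by (intro exI[of _ K]) (auto simp: U_def)
qed (use chain_dist_refl chain_dist_commute chain_dist_ultra in blast)+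

section \<open>The width as an integral of class numbers\<close>

locale compact_chain_metric = compact_ultrametric X "chain_dist X d"
  for X :: "'a set" and d :: "'a \<Rightarrow> 'a \<Rightarrow> real" +
  assumes nonempty: "X \<noteq> {}"
begin

abbreviation c :: "'a \<Rightarrow> 'a \<Rightarrow> real" where "c \<equiv> chain_dist X d"
abbreviation T :: "'a vertex set" where "T \<equiv> tree_vertices X d"

lemma chain_diam_attained:
  assumes "Q \<subseteq> X" "Q \<noteq> {}"
  obtains x y where "x \<in> Q" "y \<in> Q" "chain_diam X d Q = c x y"
    "\<And>u v. u \<in> Q \<Longrightarrow> v \<in> Q \<Longrightarrow> c u v \<le> chain_diam X d Q"
proof -
  obtain x y where xy: "x \<in> Q" "y \<in> Q" "\<forall>u\<in>Q. \<forall>v\<in>Q. c u v \<le> c x y"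
    using max_distance_attained[OF assms] by blast
  have "chain_diam X d Q = c x y"
    unfolding chain_diam_def using xy by (intro cSup_eq_maximum) auto
  show ?thesis
  proof (rule that[OF xy(1,2) \<open>chain_diam X d Q = c x y\<close>])
    fix u v assume "u \<in> Q" "v \<in> Q"
    then show "c u v \<le> chain_diam X d Q" using xy(3) \<open>chain_diam X d Q = c x y\<close> by simp
  qed
qed

lemma chain_dist_le_diam:
  assumes "Q \<subseteq> X" "x \<in> Q" "y \<in> Q"
  shows "c x y \<le> chain_diam X d Q"
proof -
  have "Q \<noteq> {}" using assms(2) by blast
  show ?thesis using chain_diam_attained[OF assms(1) \<open>Q \<noteq> {}\<close>] assms(2,3) by metis
qed

lemma chain_diam_mono:
  assumes "Q \<subseteq> Q'" "Q' \<subseteq> X" "Q \<noteq> {}"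
  shows "chain_diam X d Q \<le> chain_diam X d Q'"
proof -
  have "Q \<subseteq> X" using assms by auto
  obtain x y where xy: "x \<in> Q" "y \<in> Q" "chain_diam X d Q = c x y"
    by (rule chain_diam_attained[OF \<open>Q \<subseteq> X\<close> assms(3)]) blast
  show ?thesis unfolding xy(3) using assms xy by (intro chain_dist_le_diam) auto
qed

lemma cluster_classes_eq:
  "cluster_classes X d Q = (\<lambda>x. {y \<in> Q. c x y < chain_diam X d Q}) ` Q"
  by (auto simp: cluster_classes_def quotient_def image_def)

lemma in_own_class: "x \<in> X \<Longrightarrow> x \<in> Q \<Longrightarrow> 0 < chain_diam X d Q \<Longrightarrow> x \<in> {y \<in> Q. c x y < chain_diam X d Q}"
  by (simp add: refl)

lemma card_cls_pos: "Q \<subseteq> X \<Longrightarrow> Q \<noteq> {} \<Longrightarrow> 0 < t \<Longrightarrow> 0 < card (cls t ` Q)"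
  by (simp add: card_gt_0_iff finite_cls)

text \<open>Below the label, the class numbers of the children add up to that of the cluster. As
  the diameter is attained, there are at least two children, so each has a smaller class number.\<close>

lemma cluster_classes_count:
  assumes Q: "Q \<subseteq> X" "Q \<noteq> {}" and t: "0 < t" "t < chain_diam X d Q"
  shows "finite (cluster_classes X d Q)"
    and "2 \<le> card (cluster_classes X d Q)"
    and "card (cls t ` Q) = (\<Sum>C\<in>cluster_classes X d Q. card (cls t ` C))"
    and "C \<in> cluster_classes X d Q \<Longrightarrow> card (cls t ` C) < card (cls t ` Q)"
proof -
  define r where "r = chain_diam X d Q"
  define B where "B x = {y \<in> Q. c x y < r}" for x
  define CC where "CC = cluster_classes X d Q"
  have r: "0 < r" "t < r" using t by (auto simp: r_def)
  have CC: "CC = B ` Q" by (simp add: CC_def cluster_classes_eq B_def r_def)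
  have self: "x \<in> B x" if "x \<in> Q" for x using that Q r refl[of x] by (auto simp: B_def)
  have B_eq: "B x = B y" if "x \<in> Q" "y \<in> Q" "c x y < r" for x y
  proof -
    have "c x z < r \<longleftrightarrow> c y z < r" if "z \<in> Q" for z
    proof -
      have X: "x \<in> X" "y \<in> X" "z \<in> X" using Q(1) \<open>x \<in> Q\<close> \<open>y \<in> Q\<close> that by auto
      show ?thesis
        using ultra[OF X(1,2,3)] ultra[OF X(2,1,3)] sym[OF X(1,2)] \<open>c x y < r\<close> by auto
    qed
    then show ?thesis by (auto simp: B_def)
  qed
  obtain K where K: "finite K" "K \<subseteq> Q" "cls t ` K = cls t ` Q"
    using finite_cls[OF t(1) Q(1)] by (metis finite_subset_image subset_refl)
  have "CC \<subseteq> B ` K"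
  proof
    fix C assume "C \<in> CC"
    then obtain x where x: "x \<in> Q" "C = B x" by (auto simp: CC)
    then obtain k where k: "k \<in> K" "cls t x = cls t k" using K(3) by (metis imageE imageI)
    then have "c x k \<le> t" using x K(2) Q(1) t(1) by (subst cls_eq_iff[symmetric]) auto
    then have "B x = B k" using x k K(2) r by (intro B_eq) auto
    then show "C \<in> B ` K" using x k by blast
  qed
  then have fin: "finite CC" using K(1) by (meson finite_imageI finite_subset)
  obtain p q where pq: "p \<in> Q" "q \<in> Q" "r = c p q"
    unfolding r_def by (rule chain_diam_attained[OF Q]) blast
  have "B p \<noteq> B q" using self[OF pq(2)] pq(3) by (auto simp: B_def)
  then have two: "2 \<le> card CC"
    using card_mono[OF fin, of "{B p, B q}"] pq by (auto simp: CC)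
  have disj: "cls t ` C \<inter> cls t ` C' = {}" if C: "C \<in> CC" "C' \<in> CC" "C \<noteq> C'" for C C'
  proof (rule ccontr)
    assume "cls t ` C \<inter> cls t ` C' \<noteq> {}"
    then obtain u v where uv: "u \<in> C" "v \<in> C'" "cls t u = cls t v" by blast
    obtain x y where xy: "x \<in> Q" "y \<in> Q" "C = B x" "C' = B y" using C by (auto simp: CC)
    have uvQ: "u \<in> Q" "v \<in> Q" "c x u < r" "c y v < r" using uv xy by (auto simp: B_def)
    then have "c u v \<le> t" using uv(3) Q(1) t(1) by (subst cls_eq_iff[symmetric]) auto
    then have "B u = B v" using uvQ r by (intro B_eq) auto
    moreover have "B x = B u" "B y = B v" using B_eq xy(1,2) uvQ by blast+
    ultimately show False using C(3) xy by simp
  qed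
  have "\<Union>CC = Q" using self by (auto simp: CC B_def)
  then have "cls t ` Q = (\<Union>C\<in>CC. cls t ` C)" by auto
  also have "card \<dots> = (\<Sum>C\<in>CC. card (cls t ` C))"
    using fin disj \<open>\<Union>CC = Q\<close> Q t by (intro card_UN_disjoint ballI finite_cls impI) auto
  finally have sum: "card (cls t ` Q) = (\<Sum>C\<in>CC. card (cls t ` C))" .
  show "finite (cluster_classes X d Q)" "2 \<le> card (cluster_classes X d Q)"
    "card (cls t ` Q) = (\<Sum>C\<in>cluster_classes X d Q. card (cls t ` C))"
    using fin two sum by (simp_all add: CC_def)
  show "card (cls t ` C) < card (cls t ` Q)" if "C \<in> cluster_classes X d Q"
  proof -
    have C: "C \<in> CC" using that by (simp add: CC_def)
    have "card (CC - {C}) \<noteq> 0" using two C fin by simp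
    then obtain C' where C': "C' \<in> CC" "C' \<noteq> C" by (metis Diff_iff card.empty equals0I insertI1)
    have "C' \<subseteq> X" "C' \<noteq> {}" using C'(1) self Q by (auto simp: CC B_def)
    then have "card (cls t ` C) < card (cls t ` C) + card (cls t ` C')"
      using card_cls_pos t(1) by simp
    also have "\<dots> = (\<Sum>D\<in>{C, C'}. card (cls t ` D))" using C' by simp
    also have "\<dots> \<le> card (cls t ` Q)"
      unfolding sum using C C' fin by (intro sum_mono2) auto
    finally show ?thesis .
  qed
qed

lemma children_cases:
  assumes "u \<in> children X d v"
  obtains C where "u = C # v" "C \<in> cluster_classes X d (cluster v)" "0 < label X d v"
  using assms by (auto simp: children_def split: if_splits)

lemma tree_vertex_cluster:
  assumes "v \<in> T"
  shows "v \<noteq> [] \<and> cluster v \<subseteq> X \<and> cluster v \<noteq> {}"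
  using assms
proof (induction rule: tree_vertices.induct)
  case root
  then show ?case using nonempty by (simp add: cluster_def)
next
  case (child v u)
  from child.hyps(2) obtain C where C: "u = C # v" "C \<in> cluster_classes X d (cluster v)" "0 < label X d v"
    by (rule children_cases)
  then obtain x where x: "x \<in> cluster v" "C = {y \<in> cluster v. c x y < chain_diam X d (cluster v)}"
    by (auto simp: cluster_classes_eq)
  then have "x \<in> C" using in_own_class[of x "cluster v"] C(3) child.IH by (auto simp: label_def)
  then show ?case using C(1) x(2) child.IH by (auto simp: cluster_def)
qed

lemma descendant_via_child:
  assumes "us @ v \<in> T" "v \<in> T" "us \<noteq> []"
  shows "\<exists>C. C \<in> cluster_classes X d (cluster v) \<and> 0 < label X d v \<and> (\<exists>us'. us @ v = us' @ C # v)"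
  using assms(1,3)
proof (induction "us @ v" arbitrary: us rule: tree_vertices.induct)
  case root
  then have "v = []" by (cases us) auto
  then show ?case using tree_vertex_cluster[OF assms(2)] by simp
next
  case (child w)
  from child.hyps(3) obtain C where C: "us @ v = C # w" "C \<in> cluster_classes X d (cluster w)" "0 < label X d w"
    by (rule children_cases)
  with child.prems obtain us'' where us'': "us = C # us''" "w = us'' @ v" by (cases us) auto
  show ?case
  proof (cases "us'' = []")
    case True
    then show ?thesis using C us'' by auto
  next
    case False
    from child.hyps(2)[OF us''(2) this] us'' show ?thesis by (metis append_Cons)
  qed
qed

lemma descendant_cluster_subset:
  assumes "us @ v \<in> T"
  shows "cluster (us @ v) \<subseteq> cluster v \<or> v = []"
  using assms
proof (induction "us @ v" arbitrary: us rule: tree_vertices.induct)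
  case root
  then show ?case by (cases us) (auto simp: cluster_def)
next
  case (child w)
  from child.hyps(3) obtain C where C: "us @ v = C # w" "C \<in> cluster_classes X d (cluster w)"
    by (rule children_cases)
  then have sub: "cluster (us @ v) \<subseteq> cluster w" by (auto simp: cluster_def cluster_classes_eq)
  show ?case
  proof (cases us)
    case (Cons C' us'')
    then have "w = us'' @ v" using C by auto
    from child.hyps(2)[OF this] sub show ?thesis using \<open>w = us'' @ v\<close> by auto
  qed auto
qed

definition descendants :: "'a vertex \<Rightarrow> real \<Rightarrow> 'a vertex set" where
  "descendants v t = {u \<in> T. (\<exists>us. u = us @ v) \<and> t < label X d u}"

lemma descendant_label_le:
  assumes "us @ v \<in> T" "v \<in> T"
  shows "label X d (us @ v) \<le> label X d v"
  unfolding label_def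
  using descendant_cluster_subset[OF assms(1)] tree_vertex_cluster[OF assms(1)] tree_vertex_cluster[OF assms(2)]
  by (intro chain_diam_mono) auto

text \<open>Splitting a class into \<open>n\<close> children raises the number of classes by \<open>n - 1\<close>. The
  induction on the class number is possible because a vertex with label above \<open>t\<close> has at least two
  children, and it also shows that finitely many vertices have a label above \<open>t\<close>.\<close>

lemma descendants_count:
  assumes "v \<in> T" "0 < t"
  shows "finite (descendants v t) \<and>
    1 + (\<Sum>u\<in>descendants v t. card (children X d u) - 1) = card (cls t ` cluster v)"
  using assms(1)
proof (induction "card (cls t ` cluster v)" arbitrary: v rule: less_induct)
  case less
  note v = tree_vertex_cluster[OF less.prems]
  let ?CC = "cluster_classes X d (cluster v)"
  show ?case
  proof (cases "t < label X d v")
    case False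
    have "\<not> t < label X d (us @ v)" if "us @ v \<in> T" for us
      using descendant_label_le[OF that less.prems] False by simp
    then have "descendants v t = {}" by (auto simp: descendants_def)
    moreover have "card (cls t ` cluster v) = 1"
    proof -
      obtain x where x: "x \<in> cluster v" using v by blast
      have "cls t y = cls t x" if "y \<in> cluster v" for y
      proof -
        have "c y x \<le> chain_diam X d (cluster v)"
          using v x that by (intro chain_dist_le_diam) auto
        also have "\<dots> \<le> t" using False by (simp add: label_def)
        finally show ?thesis using v x that assms(2) by (subst cls_eq_iff) auto
      qed
      then have "cls t ` cluster v = {cls t x}" using x by blast
      then show ?thesis by simp
    qed
    ultimately show ?thesis by simp
  next
    case True
    then have pos: "0 < label X d v" using assms(2) by simp
    have children: "children X d v = (\<lambda>C. C # v) ` ?CC" using pos by (simp add: children_def)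
    have diam: "t < chain_diam X d (cluster v)" using True by (simp add: label_def)
    note count = cluster_classes_count[OF conjunct1[OF conjunct2[OF v]] conjunct2[OF conjunct2[OF v]] assms(2) diam]
    have child_T: "C # v \<in> T" if "C \<in> ?CC" for C
      using less.prems that children by (auto intro: tree_vertices.child)
    have IH: "finite (descendants (C # v) t)"
      "1 + (\<Sum>u\<in>descendants (C # v) t. card (children X d u) - 1) = card (cls t ` C)" if "C \<in> ?CC" for C
      using less.hyps[of "C # v"] child_T[OF that] count(4)[OF that] by (auto simp: cluster_def)
    have split: "descendants v t = insert v (\<Union>C\<in>?CC. descendants (C # v) t)"
    proof (intro equalityI subsetI)
      fix u assume "u \<in> descendants v t"
      then obtain us where u: "u \<in> T" "u = us @ v" "t < label X d u" by (auto simp: descendants_def)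
      show "u \<in> insert v (\<Union>C\<in>?CC. descendants (C # v) t)"
      proof (cases "us = []")
        case False
        then obtain C us' where "C \<in> ?CC" "us @ v = us' @ C # v"
          using descendant_via_child[of us v] u less.prems by blast
        then show ?thesis using u by (auto simp: descendants_def)
      qed (use u in simp)
    next
      fix u assume "u \<in> insert v (\<Union>C\<in>?CC. descendants (C # v) t)"
      then show "u \<in> descendants v t"
      proof
        assume "u = v"
        then show ?thesis using True less.prems by (auto simp: descendants_def)
      next
        assume "u \<in> (\<Union>C\<in>?CC. descendants (C # v) t)"
        then obtain C us where "u \<in> T" "u = (us @ [C]) @ v" "t < label X d u" by (auto simp: descendants_def)
        then show ?thesis unfolding descendants_def by blast
      qed
    qed
    have disj: "descendants (C # v) t \<inter> descendants (C' # v) t = {}" if "C \<noteq> C'" for C C'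
      using that by (auto simp: descendants_def)
    have notin: "v \<notin> (\<Union>C\<in>?CC. descendants (C # v) t)"
      by (auto simp: descendants_def dest: arg_cong[where f = length])
    have fin: "finite (\<Union>C\<in>?CC. descendants (C # v) t)" using count(1) IH(1) by blast
    have "card (children X d v) = card ?CC"
      unfolding children by (intro card_image inj_onI) simp
    then have "1 + (\<Sum>u\<in>descendants v t. card (children X d u) - 1)
        = card ?CC + (\<Sum>u\<in>(\<Union>C\<in>?CC. descendants (C # v) t). card (children X d u) - 1)"
      unfolding split using fin notin count(2) by simp
    also have "(\<Sum>u\<in>(\<Union>C\<in>?CC. descendants (C # v) t). card (children X d u) - 1)
        = (\<Sum>C\<in>?CC. \<Sum>u\<in>descendants (C # v) t. card (children X d u) - 1)"
      using count(1) IH(1) disj by (intro sum.UNION_disjoint) auto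
    also have "card ?CC + \<dots> = (\<Sum>C\<in>?CC. 1 + (\<Sum>u\<in>descendants (C # v) t. card (children X d u) - 1))"
      by (simp only: sum.distrib) simp
    also have "\<dots> = card (cls t ` cluster v)"
      unfolding count(3) using IH(2) by (intro sum.cong) auto
    finally show ?thesis using fin split by simp
  qed
qed

lemma class_number_eq_sum:
  assumes "0 < t"
  shows "finite {v \<in> T. t < label X d v}"
    and "card (cls t ` X) - 1 = (\<Sum>v | v \<in> T \<and> t < label X d v. card (children X d v) - 1)"
proof -
  have "\<exists>us. u = us @ [X]" if "u \<in> T" for u
    using that
  proof (induction rule: tree_vertices.induct)
    case (child v u)
    then obtain us where "v = us @ [X]" by blast
    moreover obtain C where "u = C # v" using child.hyps(2) by (rule children_cases)
    ultimately show ?case by (metis append_Cons)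
  qed simp
  then have eq: "descendants [X] t = {v \<in> T. t < label X d v}" by (auto simp: descendants_def)
  have *: "finite (descendants [X] t) \<and>
    1 + (\<Sum>u\<in>descendants [X] t. card (children X d u) - 1) = card (cls t ` cluster [X])"
    using tree_vertices.root assms by (rule descendants_count)
  show "finite {v \<in> T. t < label X d v}" using * unfolding eq by blast
  show "card (cls t ` X) - 1 = (\<Sum>v | v \<in> T \<and> t < label X d v. card (children X d v) - 1)"
    using * unfolding eq cluster_def list.sel by linarith
qed

text \<open>Subtraction on natural numbers matches the class numbers under the integral. It gives the
  summand of the width, since a vertex has at least two children or label \<open>0\<close>.\<close>

definition contribution :: "'a vertex \<Rightarrow> real" where
  "contribution v = label X d v * real (card (children X d v) - 1)"

lemma label_nonneg:
  assumes "v \<in> T"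
  shows "0 \<le> label X d v"
proof -
  have v: "cluster v \<subseteq> X" "cluster v \<noteq> {}" using tree_vertex_cluster[OF assms] by auto
  obtain x y where xy: "x \<in> cluster v" "y \<in> cluster v" "chain_diam X d (cluster v) = c x y"
    by (rule chain_diam_attained[OF v]) blast
  then have "0 \<le> c x y" using v by (intro nonneg) auto
  then show ?thesis using xy(3) by (simp add: label_def)
qed

lemma contribution_eq:
  assumes "v \<in> T"
  shows "label X d v * (real (card (children X d v)) - 1) = contribution v"
proof (cases "label X d v = 0")
  case False
  then have pos: "0 < label X d v" using label_nonneg[OF assms] by simp
  have v: "cluster v \<subseteq> X" "cluster v \<noteq> {}" using tree_vertex_cluster[OF assms] by auto
  have "finite (cluster_classes X d (cluster v))" "2 \<le> card (cluster_classes X d (cluster v))"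
    using cluster_classes_count(1,2)[OF v, of "label X d v / 2"] pos by (auto simp: label_def)
  moreover have "card (children X d v) = card (cluster_classes X d (cluster v))"
    using pos by (auto simp: children_def intro!: card_image inj_onI)
  ultimately show ?thesis by (simp add: contribution_def of_nat_diff)
qed (simp add: contribution_def)

lemma contribution_nonneg: "v \<in> T \<Longrightarrow> 0 \<le> contribution v"
  using label_nonneg[of v] by (simp add: contribution_def)

lemma width_eq_SUP:
  "width X d = (SUP F\<in>{F. finite F \<and> F \<subseteq> T}. ereal (\<Sum>v\<in>F. contribution v))"
proof -
  have "width X d = (\<Sum>\<^sub>\<infinity>v\<in>T. ereal (contribution v))"
    unfolding width_def by (intro infsum_cong) (simp add: contribution_eq)
  also have "\<dots> = (SUP F\<in>{F. finite F \<and> F \<subseteq> T}. \<Sum>v\<in>F. ereal (contribution v))"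
    by (intro nonneg_infsum_complete) (simp add: contribution_nonneg)
  finally show ?thesis by simp
qed

lemma contribution_sum_as_integral:
  assumes "finite F" "F \<subseteq> T"
  shows "ennreal (\<Sum>v\<in>F. contribution v) =
    (\<integral>\<^sup>+t\<in>{0<..}. of_nat (\<Sum>v | v \<in> F \<and> t < label X d v. card (children X d v) - 1) \<partial>lborel)"
proof -
  let ?a = "\<lambda>v. card (children X d v) - 1"
  let ?gap = "\<lambda>v t. of_nat (if t < label X d v then 1 else 0) * indicator {0<..} t :: ennreal"
  have "ennreal (\<Sum>v\<in>F. contribution v) = (\<Sum>v\<in>F. ennreal (contribution v))"
    using assms by (intro sum_ennreal[symmetric] contribution_nonneg) auto
  also have "\<dots> = (\<Sum>v\<in>F. of_nat (?a v) * (\<integral>\<^sup>+t. ?gap v t \<partial>lborel))"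
  proof (intro sum.cong)
    fix v assume "v \<in> F"
    then have l: "0 \<le> label X d v" using assms label_nonneg by auto
    have "ennreal (contribution v) = of_nat (?a v) * ennreal (label X d v)"
      unfolding contribution_def ennreal_of_nat_eq_real_of_nat using l
      by (subst ennreal_mult[symmetric]) (auto simp: mult.commute)
    then show "ennreal (contribution v) = of_nat (?a v) * (\<integral>\<^sup>+t. ?gap v t \<partial>lborel)"
      using nn_integral_indicator_below[OF l] by simp
  qed simp
  also have "\<dots> = (\<Sum>v\<in>F. (\<integral>\<^sup>+t. of_nat (?a v) * ?gap v t \<partial>lborel))"
    by (intro sum.cong nn_integral_cmult[symmetric] gap_measurable) auto
  also have "\<dots> = (\<integral>\<^sup>+t. (\<Sum>v\<in>F. of_nat (?a v) * ?gap v t) \<partial>lborel)"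
    by (intro nn_integral_sum[symmetric] borel_measurable_times_ennreal gap_measurable) auto
  also have "\<dots> = (\<integral>\<^sup>+t\<in>{0<..}. of_nat (\<Sum>v | v \<in> F \<and> t < label X d v. ?a v) \<partial>lborel)"
  proof (intro nn_integral_cong)
    fix t :: real
    have "(\<Sum>v | v \<in> F \<and> t < label X d v. ?a v) = (\<Sum>v\<in>F. if t < label X d v then ?a v else 0)"
      using assms(1) by (rule sum.inter_filter)
    then have "(of_nat (\<Sum>v | v \<in> F \<and> t < label X d v. ?a v) :: ennreal) =
        (\<Sum>v\<in>F. of_nat (?a v) * of_nat (if t < label X d v then 1 else 0))"
      by (simp only: of_nat_sum) (intro sum.cong, auto)
    then show "(\<Sum>v\<in>F. of_nat (?a v) * ?gap v t) =
        of_nat (\<Sum>v | v \<in> F \<and> t < label X d v. ?a v) * indicator {0<..} t"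
      by (simp only: sum_distrib_right mult.assoc)
  qed
  finally show ?thesis .
qed

text \<open>Summation over the vertices and integration over the scale are exchanged for finite sets of
  vertices only. These suffice: the width is the supremum over such sets, and only finitely many
  vertices matter at the scales above any \<open>e > 0\<close>.\<close>

lemma width_eq_class_integral: "width X d = enn2ereal class_integral"
proof (rule antisym)
  show "width X d \<le> enn2ereal class_integral"
    unfolding width_eq_SUP
  proof (intro SUP_least)
    fix F assume "F \<in> {F. finite F \<and> F \<subseteq> T}"
    then have F: "finite F" "F \<subseteq> T" by auto
    have "ennreal (\<Sum>v\<in>F. contribution v) \<le> class_integral"
      unfolding contribution_sum_as_integral[OF F] class_integral_def
    proof (intro nn_integral_mono)
      fix t :: real
      have "(\<Sum>v | v \<in> F \<and> t < label X d v. card (children X d v) - 1) \<le> card (cls t ` X) - 1" if "0 < t"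
        unfolding class_number_eq_sum(2)[OF that] using F
        by (intro sum_mono2 class_number_eq_sum(1) that) auto
      then have "(of_nat (\<Sum>v | v \<in> F \<and> t < label X d v. card (children X d v) - 1) :: ennreal)
          \<le> of_nat (card (cls t ` X) - 1)" if "0 < t"
        unfolding of_nat_le_iff using that by blast
      then show "of_nat (\<Sum>v | v \<in> F \<and> t < label X d v. card (children X d v) - 1) * indicator {0<..} t
          \<le> (of_nat (card (cls t ` X) - 1) * indicator {0<..} t :: ennreal)"
        by (simp only: indicator_def) auto
    qed
    then have "enn2ereal (ennreal (\<Sum>v\<in>F. contribution v)) \<le> enn2ereal class_integral"
      by (simp only: less_eq_ennreal.rep_eq)
    moreover have "0 \<le> (\<Sum>v\<in>F. contribution v)" using F contribution_nonneg by (intro sum_nonneg) auto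
    ultimately show "ereal (\<Sum>v\<in>F. contribution v) \<le> enn2ereal class_integral" by simp
  qed
next
  have upper: "ereal (\<Sum>v\<in>F. contribution v) \<le> width X d" if "finite F" "F \<subseteq> T" for F
    unfolding width_eq_SUP using that by (intro SUP_upper) auto
  have "class_integral \<le> e2ennreal (width X d)"
    unfolding class_integral_def
  proof (rule nn_integral_half_line_le)
    fix e :: real assume "0 < e"
    define F where "F = {v \<in> T. e < label X d v}"
    have F: "finite F" "F \<subseteq> T" using class_number_eq_sum(1)[OF \<open>0 < e\<close>] by (auto simp: F_def)
    have "(\<integral>\<^sup>+t\<in>{e<..}. of_nat (card (cls t ` X) - 1) \<partial>lborel) \<le> ennreal (\<Sum>v\<in>F. contribution v)"
      unfolding contribution_sum_as_integral[OF F]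
    proof (intro nn_integral_mono)
      fix t :: real
      show "of_nat (card (cls t ` X) - 1) * indicator {e<..} t
          \<le> (of_nat (\<Sum>v | v \<in> F \<and> t < label X d v. card (children X d v) - 1) * indicator {0<..} t :: ennreal)"
      proof (cases "e < t")
        case True
        then have "{v. v \<in> F \<and> t < label X d v} = {v. v \<in> T \<and> t < label X d v}" by (auto simp: F_def)
        then show ?thesis using True \<open>0 < e\<close> class_number_eq_sum(2)[of t] by simp
      qed simp
    qed
    also have "\<dots> = e2ennreal (ereal (\<Sum>v\<in>F. contribution v))" by simp
    also have "\<dots> \<le> e2ennreal (width X d)" by (intro e2ennreal_mono upper F)
    finally show "(\<integral>\<^sup>+t\<in>{e<..}. of_nat (card (cls t ` X) - 1) \<partial>lborel) \<le> e2ennreal (width X d)" .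
  next
    show "(\<lambda>t. of_nat (card (cls t ` X) - 1) * indicator {0<..} t :: ennreal) \<in> borel_measurable lborel"
      by (rule card_cls_measurable) auto
  qed
  then have "enn2ereal class_integral \<le> enn2ereal (e2ennreal (width X d))"
    by (simp only: less_eq_ennreal.rep_eq)
  also have "\<dots> = width X d" using upper[of "{}"] by (intro enn2ereal_e2ennreal) (simp add: zero_ereal_def)
  finally show "enn2ereal class_integral \<le> width X d" .
qed

section \<open>Chain developments and the width\<close>

lemma chain_development_order:
  assumes "chain_development X d f"
  shows "convex_ultrametric_order X c (\<lambda>x y. f x \<le> f y)"
proof
  fix x y z assume *: "x \<in> X" "y \<in> X" "z \<in> X" "f x \<le> f y" "f y \<le> f z"
  have dev: "c u v = chain_dist (f ` X) (\<lambda>s t. \<bar>s - t\<bar>) (f u) (f v)" if "u \<in> X" "v \<in> X" for u v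
    using assms that by (simp add: chain_development_def)
  have "c x y \<le> c x z" "c y z \<le> c x z"
    using * real_chain_dist_mono[of "f x" "f ` X" "f y" "f z"] by (simp_all add: dev)
  then show "c x z = max (c x y) (c y z)" using ultra[of x y z] * by auto
qed auto

lemma development_diam_ge:
  assumes "a \<in> X" "b \<in> X"
  shows "ereal (f b - f a) \<le> development_diam X f"
proof -
  have "ereal (f b) - ereal (f a) \<le> development_diam X f"
    unfolding development_diam_def using assms by (intro ereal_minus_mono SUP_upper INF_lower)
  then show ?thesis by simp
qed

text \<open>The span \<open>f b - f a\<close> is a real number even if the development is unbounded.\<close>

lemma width_le_development_diam:
  assumes "chain_development X d f"
  shows "width X d < \<infinity>" and "width X d \<le> development_diam X f"
proof -
  interpret convex_ultrametric_order X c "\<lambda>x y. f x \<le> f y"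
    using assms by (rule chain_development_order)
  interpret R: Metric_space "f ` X" "\<lambda>s t. \<bar>s - t\<bar>" by (rule Metric_space_real_subset)
  have "c x y \<le> f y - f x" if "x \<in> X" "y \<in> X" "f x \<le> f y" for x y
    using R.chain_dist_le_dist[of "f x" "f y"] assms that by (simp add: chain_development_def)
  then obtain a b where ab: "a \<in> X" "b \<in> X" "class_integral \<le> ennreal (f b - f a)"
    using class_integral_le_span[of f] nonempty by blast
  then have "class_integral < \<infinity>" by (simp add: order_le_less_trans)
  then show "width X d < \<infinity>"
    unfolding width_eq_class_integral by (simp add: less_top[symmetric])
  note ab(3)
  also have "ennreal (f b - f a) = e2ennreal (ereal (f b - f a))" by simp
  also have "\<dots> \<le> e2ennreal (development_diam X f)"
    by (intro e2ennreal_mono development_diam_ge ab)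
  finally have "enn2ereal class_integral \<le> enn2ereal (e2ennreal (development_diam X f))"
    by (simp only: less_eq_ennreal.rep_eq)
  also have "\<dots> = development_diam X f"
    using development_diam_ge[OF ab(1,1), of f] by (intro enn2ereal_e2ennreal) (simp add: zero_ereal_def)
  finally show "width X d \<le> development_diam X f" by (simp only: width_eq_class_integral)
qed

text \<open>All positions lie between \<open>0\<close> and the width; equality then follows from the lower bound.\<close>

lemma minimal_development_exists:
  assumes "width X d < \<infinity>"
  shows "\<exists>f. chain_development X d f \<and> development_diam X f = width X d"
proof -
  obtain le where "convex_ultrametric_order X c le" by (rule exE[OF convex_order_exists])
  then interpret convex_ultrametric_order X c le .
  have fin: "class_integral < \<infinity>"
    using assms unfolding width_eq_class_integral by (simp add: less_top[symmetric])
  have dev: "chain_development X d position"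
    unfolding chain_development_def using chain_dist_position[OF fin] by simp
  have "development_diam X position \<le> ereal (enn2real class_integral) - ereal 0"
    unfolding development_diam_def using position_le[OF fin] position_nonneg[OF fin]
    by (intro ereal_minus_mono SUP_least INF_greatest) auto
  also have "\<dots> = width X d"
    using fin by (cases class_integral) (simp_all add: width_eq_class_integral)
  finally show ?thesis using dev width_le_development_diam(2)[OF dev] by (metis antisym)
qed

end

theorem theorem2:
  fixes X :: "'a set" and d :: "'a \<Rightarrow> 'a \<Rightarrow> real"
  assumes "Metric_space X d"
    and "compact_space (Metric_space.mtopology X d)"
    and "X \<noteq> {}"
  shows "((\<exists>f. chain_development X d f) \<longleftrightarrow> width X d < \<infinity>) \<and>
    ((\<exists>f. chain_development X d f) \<longrightarrow>
      (\<forall>f. chain_development X d f \<longrightarrow> width X d \<le> development_diam X f) \<and>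
      (\<exists>f. chain_development X d f \<and> development_diam X f = width X d))"
proof -
  interpret compact_chain_metric X d
    using Metric_space.compact_ultrametric_chain_dist[OF assms(1,2)] assms(3)
    by (simp add: compact_chain_metric_def compact_chain_metric_axioms_def)
  show ?thesis using width_le_development_diam minimal_development_exists by blast
qed

end
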